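(* Let $N\geq 3$ be an integer. Then for every $u\in C_c^\infty(\mathbb{R}^N)$, $$\int_{\mathbb{R}^N} |\Delta u|^2\, dx \;\geq\; C(N) \int_{\mathbb{R}^N} \frac{|\nabla u|^2}{|x|^2}\, dx,$$ where $$C(N):=\begin{cases} \dfrac{N^2}{4}, & N\geq 5,\\[5pt] 3, & N=4,\\[5pt] \dfrac{25}{36}, & N=3.\end{cases}$$
   Context: Functions are real-valued; $C_c^\infty(\mathbb{R}^N)$ denotes the smooth compactly supported functions on $\mathbb{R}^N$ (whose support may contain the origin), $|\cdot|$ is the Euclidean norm, $\nabla$ the gradient and $\Delta$ the Laplacian. *)

theory Defs
  imports "HOL-Analysis.Analysis"
begin

text \<open>
  Since \<^const>\<open>frechet_derivative\<close> is a choice operator, it is only meaningful where the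
  function is differentiable; the second clause therefore asks for differentiability
  before it speaks about the directional derivatives.
\<close>

primrec cont_diff :: "nat \<Rightarrow> ('a::real_normed_vector \<Rightarrow> 'b::real_normed_vector) \<Rightarrow> bool" where
  "cont_diff 0 f \<longleftrightarrow> continuous_on UNIV f"
| "cont_diff (Suc k) f \<longleftrightarrow>
     (\<forall>x. f differentiable at x) \<and> (\<forall>v. cont_diff k (\<lambda>x. frechet_derivative f (at x) v))"

definition smooth :: "('a::real_normed_vector \<Rightarrow> 'b::real_normed_vector) \<Rightarrow> bool" where
  "smooth f \<longleftrightarrow> (\<forall>k. cont_diff k f)"

definition test_functions :: "('a::real_normed_vector \<Rightarrow> real) set" where
  "test_functions = {u. smooth u \<and> compact (closure (support_on UNIV u))}"

definition partial_deriv :: "'n::finite \<Rightarrow> (real^'n \<Rightarrow> real) \<Rightarrow> real^'n \<Rightarrow> real" where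
  "partial_deriv i u x = frechet_derivative u (at x) (axis i 1)"

definition gradient :: "(real^'n::finite \<Rightarrow> real) \<Rightarrow> real^'n \<Rightarrow> real^'n" where
  "gradient u x = (\<chi> i. partial_deriv i u x)"

definition laplacian :: "(real^'n::finite \<Rightarrow> real) \<Rightarrow> real^'n \<Rightarrow> real" where
  "laplacian u x = (\<Sum>i\<in>UNIV. partial_deriv i (partial_deriv i u) x)"

lemma GDERIV_gradient:
  fixes u :: "real^'n::finite \<Rightarrow> real"
  assumes "u differentiable at x"
  shows "GDERIV u x :> gradient u x"
proof -
  have D: "(u has_derivative frechet_derivative u (at x)) (at x)"
    using assms frechet_derivative_works by blast
  then have lin: "linear (frechet_derivative u (at x))"
    by (rule has_derivative_linear)
  have "frechet_derivative u (at x) h = h \<bullet> gradient u x" for h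
  proof -
    have "frechet_derivative u (at x) h = frechet_derivative u (at x) (\<Sum>i\<in>UNIV. h $ i *\<^sub>R axis i 1)"
      using basis_expansion[of h] by (simp add: scalar_mult_eq_scaleR)
    also have "\<dots> = (\<Sum>i\<in>UNIV. h $ i * partial_deriv i u x)"
      by (simp add: linear_sum[OF lin] linear_scale[OF lin] partial_deriv_def)
    finally show ?thesis
      by (simp add: inner_vec_def gradient_def)
  qed
  then have "frechet_derivative u (at x) = (\<lambda>h. h \<bullet> gradient u x)"
    by blast
  with D show ?thesis
    by (simp add: gderiv_def)
qed

text \<open>Only meaningful for dimensions \<open>N \<ge> 3\<close>; the last case is \<open>N = 3\<close>.\<close>

definition hardy_rellich_const :: "nat \<Rightarrow> real" where
  "hardy_rellich_const N =
     (if N \<ge> 5 then (real N)\<^sup>2 / 4 else if N = 4 then 3 else 25 / 36)"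

end

theory Submission
  imports Defs
begin

text \<open>
  Let \<open>D = x \<bullet> \<nabla>\<close> generate dilations, let \<open>X\<^sub>i\<^sub>j = x\<^sub>i \<partial>\<^sub>j - x\<^sub>j \<partial>\<^sub>i\<close> generate rotations and put
  \<open>\<Lambda> = 1/2 \<Sum> X\<^sub>i\<^sub>j\<^sup>2\<close>, so that \<open>|x|\<^sup>2 \<Delta> = D\<^sup>2 + (N - 2) D + \<Lambda>\<close> and
  \<open>|x|\<^sup>2 |\<nabla>u|\<^sup>2 = (D u)\<^sup>2 + 1/2 \<Sum> (X\<^sub>i\<^sub>j u)\<^sup>2\<close>. In the inner product with weight \<open>|x|\<^sup>-\<^sup>4\<close>, on test
  functions vanishing at the origin, every \<open>X\<^sub>i\<^sub>j\<close> and \<open>D + a\<close> with \<open>a = (N - 4) / 2\<close> are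
  antisymmetric; moreover \<open>D\<close> and \<open>\<Lambda>\<close> commute with every \<open>X\<^sub>i\<^sub>j\<close>. With
  \<open>B = 1/2 \<Sum> \<parallel>X\<^sub>i\<^sub>j u\<parallel>\<^sup>2\<close>, expanding the square and dropping the nonnegative terms
  \<open>\<parallel>(D + a) D u\<parallel>\<^sup>2\<close> and \<open>\<parallel>(D + a) X\<^sub>i\<^sub>j u\<parallel>\<^sup>2\<close> gives
  \<open>\<parallel>|x|\<^sup>2 \<Delta>u\<parallel>\<^sup>2 \<ge> N\<^sup>2/4 \<parallel>D u\<parallel>\<^sup>2 + a N B + \<parallel>\<Lambda> u\<parallel>\<^sup>2\<close>. A Bochner argument on spheres yields
  \<open>\<parallel>\<Lambda> u\<parallel>\<^sup>2 \<ge> (N - 1) B\<close>, which suffices for \<open>N \<ge> 4\<close>. For \<open>N = 3\<close> one also uses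
  \<open>\<parallel>\<Lambda> u + 4 D u\<parallel>\<^sup>2 \<ge> 0\<close> together with \<open>\<langle>\<Lambda> u, D u\<rangle> = a B\<close>. Working with \<open>D u\<close> and \<open>X\<^sub>i\<^sub>j u\<close> only, never
  with \<open>u\<close> itself, keeps all integrals finite at the origin in low dimensions.
\<close>

subsection \<open>Smooth functions and partial derivatives\<close>

lemma cont_diff_imp_continuous:
  "cont_diff k f \<Longrightarrow> continuous_on UNIV f"
  by (cases k) (simp_all add: differentiable_imp_continuous_on differentiable_on_def)

lemma cont_diff_Suc_D: "cont_diff (Suc k) f \<Longrightarrow> cont_diff k f"
proof (induction k arbitrary: f)
  case 0
  then show ?case
    using cont_diff_imp_continuous[of "Suc 0" f] by simp
next
  case (Suc k)
  have "f differentiable at x" "cont_diff (Suc k) (\<lambda>x. frechet_derivative f (at x) v)" for x v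
    using Suc.prems by (auto simp only: cont_diff.simps(2)[of "Suc k"])
  with Suc.IH show ?case by simp
qed

lemma cont_diff_zero: "cont_diff k (\<lambda>x. 0)"
  by (induction k) auto

lemma cont_diff_const: "cont_diff k (\<lambda>x. c)"
  by (cases k) (auto simp: cont_diff_zero)

lemma cont_diff_add:
  "cont_diff k f \<Longrightarrow> cont_diff k g \<Longrightarrow> cont_diff k (\<lambda>x. f x + g x)"
proof (induction k arbitrary: f g)
  case 0
  then show ?case by (auto intro: continuous_intros)
next
  case (Suc k)
  have "frechet_derivative (\<lambda>x. f x + g x) (at x) =
      (\<lambda>v. frechet_derivative f (at x) v + frechet_derivative g (at x) v)" for x
    using Suc.prems
    by (intro frechet_derivative_at[symmetric] has_derivative_add) (auto simp: frechet_derivative_works[symmetric])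
  with Suc show ?case by (auto intro: differentiable_add)
qed

lemma cont_diff_mult:
  fixes f g :: "'a::real_normed_vector \<Rightarrow> real"
  shows "cont_diff k f \<Longrightarrow> cont_diff k g \<Longrightarrow> cont_diff k (\<lambda>x. f x * g x)"
proof (induction k arbitrary: f g)
  case 0
  then show ?case by (auto intro: continuous_intros)
next
  case (Suc k)
  have "frechet_derivative (\<lambda>x. f x * g x) (at x) =
      (\<lambda>v. f x * frechet_derivative g (at x) v + frechet_derivative f (at x) v * g x)" for x
    using Suc.prems
    by (intro frechet_derivative_at[symmetric] has_derivative_mult) (auto simp: frechet_derivative_works[symmetric])
  \<comment> \<open>The product rule leaves one factor undifferentiated, so the induction hypothesis
    is also applied to \<open>f\<close> and \<open>g\<close> themselves at order
    \<open>k\<close>.\<close>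
  moreover have "cont_diff k f" "cont_diff k g"
    using Suc.prems by (auto intro: cont_diff_Suc_D)
  ultimately show ?case
    using Suc by (auto intro!: differentiable_mult cont_diff_add)
qed

lemma smooth_const [simp]: "smooth (\<lambda>x. c)"
  by (simp add: smooth_def cont_diff_const)

lemma smooth_bounded_linear:
  assumes "bounded_linear f" shows "smooth f"
proof -
  have "frechet_derivative f (at x) = f" for x
    using bounded_linear_imp_has_derivative[OF assms] by (metis frechet_derivative_at)
  then have "cont_diff k f" for k
    using assms by (cases k) (auto simp: cont_diff_const linear_continuous_on
        intro: bounded_linear_imp_differentiable)
  then show ?thesis by (simp add: smooth_def)
qed

lemma smooth_component [simp]: "smooth (\<lambda>x::real^'n::finite. x $ i)"
  by (intro smooth_bounded_linear bounded_linear_vec_nth)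

lemma smooth_add: "smooth f \<Longrightarrow> smooth g \<Longrightarrow> smooth (\<lambda>x. f x + g x)"
  by (simp add: smooth_def cont_diff_add)

lemma smooth_mult:
  fixes f g :: "'a::real_normed_vector \<Rightarrow> real"
  shows "smooth f \<Longrightarrow> smooth g \<Longrightarrow> smooth (\<lambda>x. f x * g x)"
  by (simp add: smooth_def cont_diff_mult)

lemma smooth_differentiable: "smooth f \<Longrightarrow> f differentiable at x"
  unfolding smooth_def by (meson cont_diff.simps(2))

lemma smooth_continuous: "smooth f \<Longrightarrow> continuous_on UNIV f"
  unfolding smooth_def by (meson cont_diff.simps(1))

lemma smooth_frechet:
  assumes "smooth f" shows "smooth (\<lambda>x. frechet_derivative f (at x) v)"
proof -
  have "cont_diff (Suc k) f" for k
    using assms by (simp add: smooth_def del: cont_diff.simps)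
  then show ?thesis by (simp add: smooth_def)
qed

lemma smooth_partial: "smooth u \<Longrightarrow> smooth (partial_deriv i u)"
  using smooth_frechet[of u "axis i 1"] by (simp add: partial_deriv_def[abs_def])

section \<open>Symmetry of second derivatives\<close>

lemma DERIV_along_line:
  fixes g :: "'a::real_normed_vector \<Rightarrow> real"
  assumes "g differentiable at (y + t *\<^sub>R z)"
  shows "DERIV (\<lambda>t. g (y + t *\<^sub>R z)) t :> frechet_derivative g (at (y + t *\<^sub>R z)) z"
proof -
  have "(g has_derivative frechet_derivative g (at (y + t *\<^sub>R z))) (at (y + t *\<^sub>R z))"
    using assms frechet_derivative_works by blast
  then have D: "((\<lambda>t. g (y + t *\<^sub>R z)) has_derivative
      (\<lambda>d. frechet_derivative g (at (y + t *\<^sub>R z)) (d *\<^sub>R z))) (at t)"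
    by (rule has_derivative_compose[rotated]) (auto intro!: derivative_eq_intros)
  have "frechet_derivative g (at (y + t *\<^sub>R z)) (d *\<^sub>R z) = frechet_derivative g (at (y + t *\<^sub>R z)) z * d" for d
    using linear_scale[OF linear_frechet_derivative[OF assms]] by (simp add: mult.commute)
  with D show ?thesis by (simp add: has_field_derivative_def)
qed

text \<open>The left-hand side is symmetric in \<open>v\<close> and \<open>w\<close>, whence the symmetry of second derivatives.\<close>

lemma second_difference_mean_value:
  fixes f :: "'a::real_normed_vector \<Rightarrow> real"
  assumes f: "\<And>x. f differentiable at x"
    and f': "\<And>x. (\<lambda>x. frechet_derivative f (at x) v) differentiable at x" and h: "h > 0"
  shows "\<exists>s t. 0 < s \<and> s < h \<and> 0 < t \<and> t < h \<and>
    f (x + h *\<^sub>R v + h *\<^sub>R w) - f (x + h *\<^sub>R v) - f (x + h *\<^sub>R w) + f x =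
    h\<^sup>2 * frechet_derivative (\<lambda>x. frechet_derivative f (at x) v) (at (x + s *\<^sub>R v + t *\<^sub>R w)) w"
proof -
  \<comment> \<open>The second difference is the increment of \<open>g\<close>, that is, of the
    \<open>w\<close>-increment of \<open>f\<close> moved in direction \<open>v\<close>. The mean
    value theorem is applied first along \<open>v\<close>, then along \<open>w\<close> to the
    directional derivative.\<close>
  define g where "g t = f (x + h *\<^sub>R w + t *\<^sub>R v) - f (x + t *\<^sub>R v)" for t
  have "DERIV g t :> frechet_derivative f (at (x + h *\<^sub>R w + t *\<^sub>R v)) v - frechet_derivative f (at (x + t *\<^sub>R v)) v" for t
    unfolding g_def by (intro DERIV_diff DERIV_along_line f)
  from MVT2[OF h this] obtain s where s: "0 < s" "s < h"
    and gs: "g h - g 0 = h * (frechet_derivative f (at (x + h *\<^sub>R w + s *\<^sub>R v)) v - frechet_derivative f (at (x + s *\<^sub>R v)) v)"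
    by auto
  from MVT2[OF h DERIV_along_line[OF f', of "x + s *\<^sub>R v" w]] obtain t where t: "0 < t" "t < h" and
    "frechet_derivative f (at (x + s *\<^sub>R v + h *\<^sub>R w)) v - frechet_derivative f (at (x + s *\<^sub>R v)) v =
     h * frechet_derivative (\<lambda>x. frechet_derivative f (at x) v) (at (x + s *\<^sub>R v + t *\<^sub>R w)) w"
    by auto
  with gs have "g h - g 0 = h\<^sup>2 * frechet_derivative (\<lambda>x. frechet_derivative f (at x) v) (at (x + s *\<^sub>R v + t *\<^sub>R w)) w"
    by (simp add: power2_eq_square add_ac)
  with s t show ?thesis by (auto simp: g_def algebra_simps)
qed

text \<open>Schwarz's theorem: by \<open>second_difference_mean_value\<close> both mixed
  derivatives, taken at suitable points near \<open>x\<close>, equal the same second difference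
  divided by \<open>h\<^sup>2\<close>. Continuity carries the equality to \<open>x\<close>.\<close>

lemma frechet_derivative_commute:
  fixes f :: "'a::real_normed_vector \<Rightarrow> real"
  assumes "smooth f"
  shows "frechet_derivative (\<lambda>x. frechet_derivative f (at x) v) (at x) w =
         frechet_derivative (\<lambda>x. frechet_derivative f (at x) w) (at x) v" (is "?A x = ?B x")
proof (rule ccontr)
  assume ne: "?A x \<noteq> ?B x"
  \<comment> \<open>Half the gap: equal values lying within \<open>e\<close> of \<open>?A x\<close>
    and of \<open>?B x\<close> respectively are impossible.\<close>
  define e where "e = \<bar>?A x - ?B x\<bar> / 2"
  have e: "e > 0" using ne by (simp add: e_def)
  have "continuous_on UNIV ?A" "continuous_on UNIV ?B"
    by (intro smooth_continuous smooth_frechet assms)+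
  then have "isCont ?A x" "isCont ?B x" by (auto simp: continuous_on_eq_continuous_at)
  then obtain d1 d2 where d: "d1 > 0" "d2 > 0"
    and d': "\<forall>y. dist y x < d1 \<longrightarrow> dist (?A y) (?A x) < e" "\<forall>y. dist y x < d2 \<longrightarrow> dist (?B y) (?B x) < e"
    using e unfolding continuous_at_eps_delta by blast
  \<comment> \<open>Scaled so that every point \<open>x + s *\<^sub>R v + t *\<^sub>R w\<close> with
    \<open>s, t < h\<close> lies within both continuity radii; the summand 1 keeps the denominator
    positive when \<open>v\<close> and \<open>w\<close> vanish.\<close>
  define h where "h = min d1 d2 / (1 + norm v + norm w)"
  have n: "1 + norm v + norm w > 0" by (simp add: add_pos_nonneg)
  have h: "h > 0" using d n by (simp add: h_def)
  have near: "dist (x + s *\<^sub>R v + t *\<^sub>R w) x < min d1 d2" if "0 < s" "s < h" "0 < t" "t < h" for s t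
  proof -
    have "dist (x + s *\<^sub>R v + t *\<^sub>R w) x \<le> s * norm v + t * norm w"
      using norm_triangle_ineq[of "s *\<^sub>R v" "t *\<^sub>R w"] that by (simp add: dist_norm add.assoc)
    also have "\<dots> \<le> h * norm v + h * norm w"
      using that by (intro add_mono mult_right_mono) auto
    also have "\<dots> < h * (1 + norm v + norm w)" using h by (simp add: algebra_simps)
    also have "\<dots> = min d1 d2" using n by (simp add: h_def)
    finally show ?thesis .
  qed
  have D: "(\<lambda>x. frechet_derivative f (at x) z) differentiable at y" for y z
    by (intro smooth_differentiable smooth_frechet assms)
  obtain s t where st: "0 < s" "s < h" "0 < t" "t < h" and 1:
    "f (x + h *\<^sub>R v + h *\<^sub>R w) - f (x + h *\<^sub>R v) - f (x + h *\<^sub>R w) + f x = h\<^sup>2 * ?A (x + s *\<^sub>R v + t *\<^sub>R w)"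
    using second_difference_mean_value[OF smooth_differentiable[OF assms] D h, of x v w] by blast
  obtain s' t' where st': "0 < s'" "s' < h" "0 < t'" "t' < h" and 2:
    "f (x + h *\<^sub>R w + h *\<^sub>R v) - f (x + h *\<^sub>R w) - f (x + h *\<^sub>R v) + f x = h\<^sup>2 * ?B (x + s' *\<^sub>R w + t' *\<^sub>R v)"
    using second_difference_mean_value[OF smooth_differentiable[OF assms] D h, of x w v] by blast
  have "h\<^sup>2 * ?A (x + s *\<^sub>R v + t *\<^sub>R w) = h\<^sup>2 * ?B (x + t' *\<^sub>R v + s' *\<^sub>R w)"
    using 1 2 by (simp add: algebra_simps)
  with h have "?A (x + s *\<^sub>R v + t *\<^sub>R w) = ?B (x + t' *\<^sub>R v + s' *\<^sub>R w)" by simp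
  moreover have "dist (?A (x + s *\<^sub>R v + t *\<^sub>R w)) (?A x) < e"
    using near[OF st] d'(1) by simp
  moreover have "dist (?B (x + t' *\<^sub>R v + s' *\<^sub>R w)) (?B x) < e"
    using near[OF st'(3,4) st'(1,2)] d'(2) by simp
  ultimately show False unfolding e_def dist_real_def by argo
qed

lemma partial_deriv_commute:
  assumes "smooth u"
  shows "partial_deriv i (partial_deriv j u) x = partial_deriv j (partial_deriv i u) x"
  using frechet_derivative_commute[OF assms, of "axis j 1" x "axis i 1"]
  by (simp add: partial_deriv_def[abs_def])

section \<open>Rules for partial derivatives\<close>

lemma partial_deriv_const [simp]: "partial_deriv i (\<lambda>x. c) x = 0"
  by (simp add: partial_deriv_def)

lemma partial_deriv_component: "partial_deriv i (\<lambda>x. x $ j) x = (if i = j then 1 else 0)"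
proof -
  have "frechet_derivative (\<lambda>x::real^'a. x $ j) (at x) = (\<lambda>x. x $ j)"
    by (intro frechet_derivative_at[symmetric] bounded_linear_imp_has_derivative bounded_linear_vec_nth)
  then show ?thesis by (simp add: partial_deriv_def axis_def)
qed

lemma partial_deriv_add:
  "f differentiable at x \<Longrightarrow> g differentiable at x \<Longrightarrow>
    partial_deriv i (\<lambda>x. f x + g x) x = partial_deriv i f x + partial_deriv i g x"
  unfolding partial_deriv_def
  by (subst frechet_derivative_at[symmetric, OF has_derivative_add]) (auto simp: frechet_derivative_works[symmetric])

lemma partial_deriv_mult:
  "f differentiable at x \<Longrightarrow> g differentiable at x \<Longrightarrow>
    partial_deriv i (\<lambda>x. f x * g x) x = f x * partial_deriv i g x + partial_deriv i f x * g x"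
  unfolding partial_deriv_def
  by (subst frechet_derivative_at[symmetric, OF has_derivative_mult]) (auto simp: frechet_derivative_works[symmetric])

lemma smooth_sum: "(\<And>i. i \<in> I \<Longrightarrow> smooth (f i)) \<Longrightarrow> smooth (\<lambda>x. \<Sum>i\<in>I. f i x)"
  by (induction I rule: infinite_finite_induct) (auto intro: smooth_add)

lemma partial_deriv_sum:
  assumes "\<And>i. i \<in> I \<Longrightarrow> smooth (f i)"
  shows "partial_deriv k (\<lambda>x. \<Sum>i\<in>I. f i x) x = (\<Sum>i\<in>I. partial_deriv k (f i) x)"
  using assms
  by (induction I rule: infinite_finite_induct)
     (auto simp: partial_deriv_add smooth_differentiable smooth_sum)

lemma partial_deriv_commute_fun:
  "smooth u \<Longrightarrow> partial_deriv i (partial_deriv j u) = partial_deriv j (partial_deriv i u)"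
  using partial_deriv_commute by blast

lemma partial_deriv_diff:
  "f differentiable at x \<Longrightarrow> g differentiable at x \<Longrightarrow>
    partial_deriv i (\<lambda>x. f x - g x) x = partial_deriv i f x - partial_deriv i g x"
  unfolding partial_deriv_def
  by (subst frechet_derivative_at[symmetric, OF has_derivative_diff]) (auto simp: frechet_derivative_works[symmetric])

lemma smooth_diff:
  fixes f g :: "'a::real_normed_vector \<Rightarrow> real"
  shows "smooth f \<Longrightarrow> smooth g \<Longrightarrow> smooth (\<lambda>x. f x - g x)"
  using smooth_add[of f "\<lambda>x. (-1) * g x"] smooth_mult[of "\<lambda>x. -1" g] by simp

text \<open>Such conditions compare indices and do not depend on the point; they come from
  differentiating coordinates, as in \<open>partial_rot\<close>.\<close>

lemma smooth_if: "smooth f \<Longrightarrow> smooth g \<Longrightarrow> smooth (\<lambda>x. if P then f x else g x)"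
  by (cases P) auto

lemmas smooth_intros = smooth_const smooth_component smooth_add smooth_diff smooth_mult smooth_sum
  smooth_partial smooth_if

subsection \<open>Rotation and dilation fields\<close>

definition rot :: "'n::finite \<Rightarrow> 'n \<Rightarrow> (real^'n \<Rightarrow> real) \<Rightarrow> real^'n \<Rightarrow> real" where
  "rot i j f = (\<lambda>x. x $ i * partial_deriv j f x - x $ j * partial_deriv i f x)"

definition euler :: "(real^'n::finite \<Rightarrow> real) \<Rightarrow> real^'n \<Rightarrow> real" where
  "euler f = (\<lambda>x. \<Sum>i\<in>UNIV. x $ i * partial_deriv i f x)"

text \<open>The quadratic Casimir element of so(N), with the factor 1/2 because each unordered pair
  is counted twice. On the sphere of radius r it is r^2 times the Laplace-Beltrami operator.\<close>

definition casimir :: "(real^'n::finite \<Rightarrow> real) \<Rightarrow> real^'n \<Rightarrow> real" where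
  "casimir f = (\<lambda>x. (1/2) * (\<Sum>i\<in>UNIV. \<Sum>j\<in>UNIV. rot i j (rot i j f) x))"

lemma smooth_rot: "smooth f \<Longrightarrow> smooth (rot i j f)"
  unfolding rot_def by (intro smooth_intros)

lemma smooth_euler: "smooth f \<Longrightarrow> smooth (euler f)"
  unfolding euler_def by (intro smooth_intros)

lemma smooth_laplacian: "smooth f \<Longrightarrow> smooth (laplacian f)"
  unfolding laplacian_def[abs_def] by (intro smooth_intros)

lemmas partial_simps = partial_deriv_mult partial_deriv_diff partial_deriv_add partial_deriv_sum
  partial_deriv_component smooth_intros smooth_differentiable

lemma partial_rot:
  assumes "smooth f"
  shows "partial_deriv k (rot i j f) x =
    (if k = i then partial_deriv j f x else 0) + x $ i * partial_deriv k (partial_deriv j f) x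
    - (if k = j then partial_deriv i f x else 0) - x $ j * partial_deriv k (partial_deriv i f) x"
  unfolding rot_def using assms by (simp add: partial_simps)

lemma partial_euler:
  assumes "smooth f"
  shows "partial_deriv k (euler f) x = partial_deriv k f x + (\<Sum>i\<in>UNIV. x $ i * partial_deriv k (partial_deriv i f) x)"
proof -
  have "partial_deriv k (euler f) x =
      (\<Sum>i\<in>UNIV. x $ i * partial_deriv k (partial_deriv i f) x + (if k = i then partial_deriv i f x else 0))"
    unfolding euler_def using assms by (subst partial_deriv_sum) (auto simp: partial_simps intro!: sum.cong smooth_intros)
  then show ?thesis by (simp add: sum.distrib)
qed

text \<open>The second-order terms agree by symmetry of the Hessian, and differentiating the linear
  coefficients yields the same first-order terms on both sides.\<close>

lemma rot_euler:
  assumes "smooth f"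
  shows "rot i j (euler f) = euler (rot i j f)"
proof
  fix x
  have "euler (rot i j f) x = (\<Sum>k\<in>UNIV. (if k = i then x $ k * partial_deriv j f x else 0)
      + x $ i * (x $ k * partial_deriv j (partial_deriv k f) x)
      - (if k = j then x $ k * partial_deriv i f x else 0)
      - x $ j * (x $ k * partial_deriv i (partial_deriv k f) x))"
    unfolding euler_def partial_rot[OF assms]
    by (intro sum.cong refl) (auto simp: algebra_simps partial_deriv_commute_fun[OF assms, of j] partial_deriv_commute_fun[OF assms, of i])
  also have "\<dots> = rot i j (euler f) x"
    unfolding rot_def partial_euler[OF assms]
    by (simp add: sum.distrib sum_subtractf sum_distrib_left algebra_simps)
  finally show "rot i j (euler f) x = euler (rot i j f) x" ..
qed

text \<open>Differentiating the coefficients of \<open>rot i j\<close> produces only twice the mixed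
  derivative in \<open>i\<close> and \<open>j\<close>, once at \<open>m = i\<close> and once, with
  opposite sign, at \<open>m = j\<close>; the sum over \<open>m\<close> cancels them.\<close>

lemma laplacian_rot:
  assumes f: "smooth f"
  shows "laplacian (rot i j f) = rot i j (laplacian f)"
proof
  fix x
  let ?d = partial_deriv
  have pp: "?d m (?d m (rot i j f)) x =
      (if m = i then 2 * ?d i (?d j f) x else 0) + x $ i * ?d j (?d m (?d m f)) x
    - (if m = j then 2 * ?d i (?d j f) x else 0) - x $ j * ?d i (?d m (?d m f)) x" for m
  proof -
    have "?d m (rot i j f) = (\<lambda>x. (if m = i then ?d j f x else 0) + x $ i * ?d m (?d j f) x
        - (if m = j then ?d i f x else 0) - x $ j * ?d m (?d i f) x)"
      using partial_rot[OF f] by blast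
    then have "?d m (?d m (rot i j f)) x =
        (if m = i then 2 * ?d i (?d j f) x else 0) + x $ i * ?d m (?d m (?d j f)) x
      - (if m = j then 2 * ?d j (?d i f) x else 0) - x $ j * ?d m (?d m (?d i f)) x"
      using f by (simp add: partial_simps)
    moreover have "?d m (?d m (?d k f)) = ?d k (?d m (?d m f))" for k
      using f partial_deriv_commute_fun[of f m k] partial_deriv_commute_fun[of "?d m f" m k]
      by (simp add: smooth_intros)
    ultimately show ?thesis using partial_deriv_commute[OF f, of i j x] by simp
  qed
  have "?d k (laplacian f) x = (\<Sum>m\<in>UNIV. ?d k (?d m (?d m f)) x)" for k
    unfolding laplacian_def[abs_def] using f by (intro partial_deriv_sum smooth_intros)
  then have "rot i j (laplacian f) x =
      x $ i * (\<Sum>m\<in>UNIV. ?d j (?d m (?d m f)) x) - x $ j * (\<Sum>m\<in>UNIV. ?d i (?d m (?d m f)) x)"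
    by (simp add: rot_def)
  then show "laplacian (rot i j f) x = rot i j (laplacian f) x"
    unfolding laplacian_def pp by (simp add: sum.distrib sum_subtractf sum_distrib_left)
qed

lemma euler_euler:
  assumes f: "smooth f"
  shows "euler (euler f) x = euler f x + (\<Sum>i\<in>UNIV. \<Sum>j\<in>UNIV. x $ i * x $ j * partial_deriv i (partial_deriv j f) x)"
proof -
  have "euler (euler f) x = (\<Sum>i\<in>UNIV. x $ i * (partial_deriv i f x + (\<Sum>j\<in>UNIV. x $ j * partial_deriv i (partial_deriv j f) x)))"
    using partial_euler[OF f] by (simp add: euler_def[of "euler f"])
  then show ?thesis
    by (simp add: euler_def sum.distrib distrib_left sum_distrib_left mult.assoc)
qed

text \<open>The splitting of the Laplacian into radial and spherical parts. It also reduces the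
  commutation of \<open>casimir\<close> with rotations to that of \<open>laplacian\<close> and
  \<open>euler\<close>.\<close>

lemma casimir_eq:
  fixes f :: "real^'n::finite \<Rightarrow> real"
  assumes f: "smooth f"
  shows "casimir f x = (x \<bullet> x) * laplacian f x - euler (euler f) x - (real CARD('n) - 2) * euler f x"
proof -
  let ?d = partial_deriv
  \<comment> \<open>For \<open>i = j\<close> the left-hand side is 0, while the first-order terms
    would contribute \<open>- 2 * (x $ i * ?d i f x)\<close>; the last summand restores
    this.\<close>
  have rr: "rot i j (rot i j f) x = (x $ i * x $ i) * ?d j (?d j f) x + (x $ j * x $ j) * ?d i (?d i f) x
     - 2 * (x $ i * x $ j * ?d i (?d j f) x) - x $ i * ?d i f x - x $ j * ?d j f x
     + (if i = j then 2 * (x $ i * ?d i f x) else 0)" for i j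
    using partial_deriv_commute[OF f, of j i x]
    unfolding rot_def[of i j "rot i j f"] partial_rot[OF f]
    by (cases "i = j") (simp_all add: algebra_simps)
  have s1: "(\<Sum>i\<in>UNIV. \<Sum>j\<in>UNIV. (x $ i * x $ i) * ?d j (?d j f) x) = (x \<bullet> x) * laplacian f x"
    by (simp add: inner_vec_def laplacian_def sum_product)
  have s2: "(\<Sum>i\<in>UNIV. \<Sum>j\<in>UNIV. (x $ j * x $ j) * ?d i (?d i f) x) = (x \<bullet> x) * laplacian f x"
    by (subst sum.swap) (rule s1)
  have "casimir f x = (x \<bullet> x) * laplacian f x
     - (\<Sum>i\<in>UNIV. \<Sum>j\<in>UNIV. x $ i * x $ j * ?d i (?d j f) x) - (real CARD('n) - 1) * euler f x"
  proof -
    have "(\<Sum>i\<in>UNIV. \<Sum>j\<in>(UNIV::'n set). x $ i * ?d i f x) = real CARD('n) * euler f x"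
      by (simp add: euler_def sum_distrib_left)
    moreover from this have "(\<Sum>i\<in>(UNIV::'n set). \<Sum>j\<in>UNIV. x $ j * ?d j f x) = real CARD('n) * euler f x"
      by (subst sum.swap)
    moreover have "(\<Sum>i\<in>UNIV. \<Sum>j\<in>UNIV. 2 * (x $ i * x $ j * ?d i (?d j f) x)) =
        2 * (\<Sum>i\<in>UNIV. \<Sum>j\<in>UNIV. x $ i * x $ j * ?d i (?d j f) x)"
      by (simp only: sum_distrib_left)
    moreover have "(\<Sum>i\<in>UNIV. \<Sum>j\<in>UNIV. if i = j then 2 * (x $ i * ?d i f x) else 0) = 2 * euler f x"
      by (simp add: euler_def sum_distrib_left)
    ultimately have "(\<Sum>i\<in>UNIV. \<Sum>j\<in>UNIV. rot i j (rot i j f) x) = (x \<bullet> x) * laplacian f x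
        + (x \<bullet> x) * laplacian f x - 2 * (\<Sum>i\<in>UNIV. \<Sum>j\<in>UNIV. x $ i * x $ j * ?d i (?d j f) x)
        - real CARD('n) * euler f x - real CARD('n) * euler f x + 2 * euler f x"
      unfolding rr sum.distrib sum_subtractf s1 s2 by (simp only:)
    then show ?thesis by (simp add: casimir_def algebra_simps)
  qed
  then show ?thesis using euler_euler[OF f, of x] by (simp add: algebra_simps)
qed

lemma smooth_inner_self: "smooth (\<lambda>x::real^'n::finite. x \<bullet> x)"
  unfolding inner_vec_def by (simp add: smooth_intros)

text \<open>Rotations annihilate \<open>x \<bullet> x\<close>: its derivatives
  \<open>2 * x $ k\<close> cancel by antisymmetry, so it behaves like a constant factor.\<close>

lemma rot_norm_mult:
  assumes f: "smooth f"
  shows "rot i j (\<lambda>x. (x \<bullet> x) * f x) x = (x \<bullet> x) * rot i j f x"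
proof -
  have "partial_deriv k (\<lambda>x. x \<bullet> x) x = 2 * x $ k" for k
  proof -
    have "partial_deriv k (\<lambda>x. x $ i * x $ i) x = (if k = i then 2 * x $ i else 0)" for i
      by (simp add: partial_simps)
    then show ?thesis
      unfolding inner_vec_def inner_real_def
      by (subst partial_deriv_sum) (simp_all add: smooth_intros)
  qed
  then show ?thesis using f
    by (simp add: rot_def partial_simps smooth_inner_self algebra_simps)
qed

lemma rot_diff: "smooth f \<Longrightarrow> smooth g \<Longrightarrow> rot i j (\<lambda>x. f x - g x) x = rot i j f x - rot i j g x"
  by (simp add: rot_def partial_simps algebra_simps)

lemma rot_cmult: "smooth f \<Longrightarrow> rot i j (\<lambda>x. c * f x) x = c * rot i j f x"
  by (simp add: rot_def partial_simps algebra_simps)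

text \<open>In the form \<open>casimir_eq\<close> every ingredient commutes with
  \<open>rot i j\<close>, so no commutators of rotations among themselves have to be
  computed.\<close>

lemma rot_casimir:
  assumes f: "smooth f"
  shows "rot i j (casimir f) = casimir (rot i j f)"
proof
  fix x :: "real^'a"
  let ?c = "real CARD('a) - 2"
  have "casimir f = (\<lambda>x. ((x \<bullet> x) * laplacian f x - euler (euler f) x) - ?c * euler f x)"
    using casimir_eq[OF f] by blast
  then have "rot i j (casimir f) x = (x \<bullet> x) * rot i j (laplacian f) x - rot i j (euler (euler f)) x - ?c * rot i j (euler f) x"
    using f by (simp add: rot_diff rot_cmult rot_norm_mult smooth_intros smooth_inner_self smooth_laplacian smooth_euler)
  then show "rot i j (casimir f) x = casimir (rot i j f) x"
    using f by (simp add: casimir_eq smooth_rot laplacian_rot rot_euler smooth_euler)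
qed

text \<open>The Binet-Cauchy identity; the factor 2 is due to summing over ordered pairs.\<close>

lemma wedge_sum:
  fixes a b c d :: "real^'n::finite"
  shows "(\<Sum>i\<in>UNIV. \<Sum>j\<in>UNIV. (a $ i * b $ j - a $ j * b $ i) * (c $ i * d $ j - c $ j * d $ i))
    = 2 * ((a \<bullet> c) * (b \<bullet> d) - (a \<bullet> d) * (b \<bullet> c))"
proof -
  have "(a $ i * b $ j - a $ j * b $ i) * (c $ i * d $ j - c $ j * d $ i) =
      (a $ i * c $ i) * (b $ j * d $ j) + (b $ i * d $ i) * (a $ j * c $ j)
      - (a $ i * d $ i) * (b $ j * c $ j) - (b $ i * c $ i) * (a $ j * d $ j)" for i j
    by (simp add: algebra_simps)
  then show ?thesis
    by (simp only: sum.distrib sum_subtractf sum_product[symmetric]) (simp add: inner_vec_def)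
qed

lemma rot_eq_wedge: "rot i j f x = x $ i * gradient f x $ j - x $ j * gradient f x $ i"
  by (simp add: rot_def gradient_def)

lemma euler_eq_inner: "euler f x = x \<bullet> gradient f x"
  by (simp add: euler_def gradient_def inner_vec_def)

text \<open>Lagrange's identity for \<open>x\<close> and the gradient: rotations see exactly the
  tangential part of the gradient, \<open>euler\<close> the radial part.\<close>

lemma sum_rot_squared:
  "(\<Sum>i\<in>UNIV. \<Sum>j\<in>UNIV. (rot i j f x)\<^sup>2) = 2 * ((x \<bullet> x) * (gradient f x \<bullet> gradient f x) - (euler f x)\<^sup>2)"
  unfolding rot_eq_wedge euler_eq_inner power2_eq_square wedge_sum
  by (simp add: inner_commute)

subsection \<open>Test functions\<close>

text \<open>Vanishing outside some ball passes to sums, products and derivatives more directly than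
  compactness of the support does.\<close>

lemma test_functions_iff:
  "u \<in> test_functions \<longleftrightarrow> smooth u \<and> (\<exists>R. \<forall>x. R < norm x \<longrightarrow> u x = 0)"
  for u :: "'a::euclidean_space \<Rightarrow> real"
proof -
  have "compact (closure (support_on UNIV u)) \<longleftrightarrow> bounded (support_on UNIV u)"
    by (auto simp: compact_eq_bounded_closed dest: bounded_subset[OF _ closure_subset])
  also have "\<dots> \<longleftrightarrow> (\<exists>R. \<forall>x. R < norm x \<longrightarrow> u x = 0)"
    unfolding bounded_iff support_on_def by (auto simp: not_less[symmetric])
  finally show ?thesis by (simp add: test_functions_def)
qed

lemma test_functions_smooth: "u \<in> test_functions \<Longrightarrow> smooth u"
  by (simp add: test_functions_def)

lemma test_functions_mult_smooth:
  fixes u g :: "'a::euclidean_space \<Rightarrow> real"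
  shows "u \<in> test_functions \<Longrightarrow> smooth g \<Longrightarrow> (\<lambda>x. g x * u x) \<in> test_functions"
  unfolding test_functions_iff by (auto simp: smooth_mult) 

lemma test_functions_add:
  fixes u g :: "'a::euclidean_space \<Rightarrow> real"
  assumes "u \<in> test_functions" "g \<in> test_functions" shows "(\<lambda>x. u x + g x) \<in> test_functions"
proof -
  obtain R R' where "\<forall>x. R < norm x \<longrightarrow> u x = 0" "\<forall>x. R' < norm x \<longrightarrow> g x = 0"
    using assms by (auto simp: test_functions_iff)
  then have "\<forall>x. max R R' < norm x \<longrightarrow> u x + g x = 0" by simp
  then have "\<exists>R. \<forall>x. R < norm x \<longrightarrow> u x + g x = 0" by blast
  then show ?thesis using assms by (simp add: test_functions_iff smooth_add)
qed

lemma partial_deriv_zero_outside: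
  fixes f :: "real^'n::finite \<Rightarrow> real"
  assumes "\<And>x. R < norm x \<Longrightarrow> f x = 0" "R < norm x"
  shows "partial_deriv i f x = 0"
proof -
  have "open {x::real^'n. R < norm x}"
    by (intro open_Collect_less continuous_intros)
  then have "frechet_derivative f (at x) = frechet_derivative (\<lambda>x. 0) (at x)"
    using assms by (intro frechet_derivative_transform_within_open[symmetric]) auto
  then show ?thesis by (simp add: partial_deriv_def)
qed

lemma test_functions_partial:
  fixes u :: "real^'n::finite \<Rightarrow> real"
  assumes "u \<in> test_functions" shows "partial_deriv i u \<in> test_functions"
proof -
  obtain R where R: "\<forall>x. R < norm x \<longrightarrow> u x = 0"
    using assms by (auto simp: test_functions_iff)
  have "partial_deriv i u x = 0" if "R < norm x" for x
    using partial_deriv_zero_outside[of R u x i] R that by blast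
  then show ?thesis using assms by (auto simp: test_functions_iff smooth_partial)
qed

lemma test_functions_zero: "(\<lambda>x::'a::euclidean_space. 0) \<in> test_functions"
  by (simp add: test_functions_iff)

lemma test_functions_sum:
  fixes f :: "'i \<Rightarrow> 'a::euclidean_space \<Rightarrow> real"
  shows "(\<And>i. i \<in> I \<Longrightarrow> f i \<in> test_functions) \<Longrightarrow> (\<lambda>x. \<Sum>i\<in>I. f i x) \<in> test_functions"
  by (induction I rule: infinite_finite_induct) (auto intro: test_functions_add test_functions_zero)

lemma test_functions_diff:
  fixes u g :: "'a::euclidean_space \<Rightarrow> real"
  assumes "u \<in> test_functions" "g \<in> test_functions" shows "(\<lambda>x. u x - g x) \<in> test_functions"
  using test_functions_add[OF assms(1) test_functions_mult_smooth[OF assms(2) smooth_const[of "-1"]]] by simp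

lemma test_functions_rot: "u \<in> test_functions \<Longrightarrow> rot i j u \<in> test_functions"
  unfolding rot_def by (intro test_functions_diff test_functions_mult_smooth test_functions_partial smooth_component)

lemma test_functions_euler: "u \<in> test_functions \<Longrightarrow> euler u \<in> test_functions"
  unfolding euler_def by (intro test_functions_sum test_functions_mult_smooth test_functions_partial smooth_component)

lemma test_functions_casimir: "u \<in> test_functions \<Longrightarrow> casimir u \<in> test_functions"
  unfolding casimir_def by (intro test_functions_mult_smooth test_functions_sum test_functions_rot smooth_const)

subsection \<open>The pointwise Bochner inequality\<close>

text \<open>Written through the Hessian columns \<open>gradient (partial_deriv l f) x\<close>, so
  that the trace in \<open>bochner_pointwise\<close> can be matched term by term.\<close>

lemma casimir_eq_hessian:
  fixes f :: "real^'n::finite \<Rightarrow> real"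
  assumes f: "smooth f"
  shows "casimir f x = (x \<bullet> x) * (\<Sum>l\<in>UNIV. gradient (partial_deriv l f) x $ l)
    - (\<Sum>l\<in>UNIV. x $ l * (x \<bullet> gradient (partial_deriv l f) x)) - (real CARD('n) - 1) * (x \<bullet> gradient f x)"
proof -
  have "(\<Sum>l\<in>UNIV. x $ l * (x \<bullet> gradient (partial_deriv l f) x)) =
      (\<Sum>j\<in>UNIV. \<Sum>l\<in>UNIV. x $ j * x $ l * partial_deriv j (partial_deriv l f) x)"
    by (subst sum.swap) (simp add: inner_vec_def gradient_def sum_distrib_left mult_ac)
  moreover have "(\<Sum>l\<in>UNIV. gradient (partial_deriv l f) x $ l) = laplacian f x"
    by (simp add: gradient_def laplacian_def)
  ultimately show ?thesis
    unfolding casimir_eq[OF f] euler_euler[OF f] by (simp add: euler_eq_inner algebra_simps)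
qed

lemma gradient_rot:
  assumes "smooth f"
  shows "gradient (rot k l f) x = gradient f x $ l *\<^sub>R axis k 1 - gradient f x $ k *\<^sub>R axis l 1
    + x $ k *\<^sub>R gradient (partial_deriv l f) x - x $ l *\<^sub>R gradient (partial_deriv k f) x"
  by (simp add: vec_eq_iff gradient_def partial_rot[OF assms] axis_def)

text \<open>By \<open>sum_rot_squared\<close> the inner sums on the right measure the tangential
  gradients of the functions \<open>rot k l f\<close>. Each of these splits into two wedge products,
  one carrying the first derivatives of \<open>f\<close> and one the spherical Hessian, and
  \<open>wedge_sum\<close> evaluates their norms.\<close>

lemma bochner_pointwise:
  fixes f :: "real^'n::finite \<Rightarrow> real"
  assumes f: "smooth f" and N: "CARD('n) \<ge> 2"
  shows "(casimir f x)\<^sup>2 / (real CARD('n) - 1)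
      + (real CARD('n) - 2) * ((1/2) * (\<Sum>i\<in>UNIV. \<Sum>j\<in>UNIV. (rot i j f x)\<^sup>2))
    \<le> (1/4) * (\<Sum>k\<in>UNIV. \<Sum>l\<in>UNIV. \<Sum>i\<in>UNIV. \<Sum>j\<in>UNIV. (rot i j (rot k l f) x)\<^sup>2)"
proof (cases "x = 0")
  case True
  then show ?thesis by (simp add: casimir_def rot_def)
next
  case False
  define s where "s = x \<bullet> x"
  have s: "s > 0" using False by (simp add: s_def)
  define n where "n = real CARD('n)"
  have n: "n - 1 > 0" using N by (simp add: n_def)
  \<comment> \<open>\<open>P\<close> is \<open>|x|\<^sup>2\<close> times the projection onto the tangent space of the sphere through \<open>x\<close>,
    \<open>z\<close> the (scaled) tangential gradient and \<open>H l\<close> the \<open>l\<close>-th column of the spherical Hessian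
    \<open>P M P - (x \<bullet> p) P\<close>. The bound is the Cauchy--Schwarz inequality
    \<open>(tr H)\<^sup>2 \<le> (n - 1) |H|\<^sup>2\<close> for this Hessian, and \<open>(n - 2) |z|\<^sup>2\<close> is the Ricci term.\<close>
  define P where "P v = s *\<^sub>R v - (x \<bullet> v) *\<^sub>R x" for v
  define p where "p = gradient f x"
  define M where "M l = gradient (partial_deriv l f) x" for l
  define Mx where "Mx = (\<Sum>m\<in>UNIV. x $ m *\<^sub>R M m)"
  define z where "z = P p"
  define H where "H l = s *\<^sub>R P (M l) - x $ l *\<^sub>R P Mx - (x \<bullet> p) *\<^sub>R P (axis l 1)" for l
  \<comment> \<open>The rows of \<open>P\<close>, which is symmetric, and below the rows
    \<open>h j\<close> of the matrix whose columns are \<open>H l\<close>. Rows are compared because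
    the component \<open>j\<close> stays fixed while the wedge sums run over \<open>k\<close> and
    \<open>l\<close>.\<close>
  define c where "c j = P (axis j 1)" for j :: 'n
  define h where "h j = (\<chi> l. H l $ j)" for j
  have P_perp: "x \<bullet> P v = 0" for v
    by (simp add: P_def inner_diff_right s_def)
  have P_norm: "P v \<bullet> P v = s * (s * (v \<bullet> v) - (x \<bullet> v)\<^sup>2)" for v
    by (simp add: P_def inner_diff_right inner_diff_left s_def[symmetric] inner_commute[of v x]
        power2_eq_square algebra_simps)
  have P_axis: "P (axis k 1) $ j = (if j = k then s else 0) - x $ k * x $ j" for k j
    by (simp add: P_def inner_axis) (simp add: axis_def)
  have sum_sq: "(\<Sum>j\<in>UNIV. x $ j * x $ j) = s"
    by (simp add: s_def inner_vec_def)
  have c_nth: "c j $ k = P (axis k 1) $ j" for j k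
    by (simp add: c_def P_axis)
  have cx: "c j \<bullet> x = 0" and zx: "z \<bullet> x = 0" for j
    using P_perp by (simp_all add: c_def z_def inner_commute)
  have cz: "c j \<bullet> z = s * z $ j" for j
    using zx by (simp add: c_def P_def[of "axis j 1"] inner_commute[of _ z] inner_diff_right inner_axis)
  \<comment> \<open>The columns \<open>H l\<close> are tangential by construction; for the rows this
    rests on the right-hand factor \<open>P\<close> in \<open>P M P\<close>, which kills
    \<open>x\<close>.\<close>
  have xh: "x \<bullet> h j = 0" for j
  proof -
    have "P Mx = (\<Sum>l\<in>UNIV. x $ l *\<^sub>R P (M l))"
      by (simp add: P_def Mx_def inner_sum_right scaleR_sum_left scaleR_sum_right sum_subtractf
          scaleR_diff_right mult.commute)
    then have PMx: "P Mx $ j = (\<Sum>l\<in>UNIV. x $ l * P (M l) $ j)"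
      by (simp add: sum_component)
    have "x $ l * P (axis l 1) $ j = (if j = l then s * x $ j else 0) - (x $ l * x $ l) * x $ j" for l
      unfolding P_axis by (cases "j = l") (auto simp: algebra_simps)
    then have "(\<Sum>l\<in>UNIV. x $ l * P (axis l 1) $ j) = 0"
      by (simp add: sum_subtractf sum_distrib_right[symmetric] sum_sq)
    moreover have "x \<bullet> h j = s * (\<Sum>l\<in>UNIV. x $ l * P (M l) $ j) - (\<Sum>l\<in>UNIV. x $ l * x $ l) * P Mx $ j
        - (x \<bullet> p) * (\<Sum>l\<in>UNIV. x $ l * P (axis l 1) $ j)"
      unfolding inner_vec_def[of x "h j"]
      by (simp add: h_def H_def sum.distrib sum_subtractf sum_distrib_left sum_distrib_right algebra_simps)
    ultimately show ?thesis using PMx sum_sq by simp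
  qed
  have cc: "(\<Sum>j\<in>UNIV. c j \<bullet> c j) = (n - 1) * s\<^sup>2"
  proof -
    have "c j \<bullet> c j = s * s - s * (x $ j * x $ j)" for j
      unfolding c_def P_norm by (simp add: inner_axis power2_eq_square algebra_simps)
    then have "(\<Sum>j\<in>UNIV. c j \<bullet> c j) = n * (s * s) - s * s"
      by (simp add: sum_subtractf sum_distrib_left[symmetric] sum_sq n_def)
    then show ?thesis by (simp add: power2_eq_square algebra_simps)
  qed
  have tr: "(\<Sum>j\<in>UNIV. h j $ j) = s * casimir f x"
  proof -
    have "h j $ j = s * (s * M j $ j) - s * (x $ j * (x \<bullet> M j)) - x $ j * P Mx $ j
        - (x \<bullet> p) * (s - x $ j * x $ j)" for j
      by (simp add: h_def H_def P_axis) (simp add: P_def algebra_simps)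
    then have "(\<Sum>j\<in>UNIV. h j $ j) = s * (s * (\<Sum>j\<in>UNIV. M j $ j)) - s * (\<Sum>j\<in>UNIV. x $ j * (x \<bullet> M j))
       - (x \<bullet> P Mx) - (x \<bullet> p) * (n * s - s)"
      by (simp add: sum_subtractf sum_distrib_left[symmetric] sum_sq n_def inner_vec_def[of x "P Mx"])
    then show ?thesis
      unfolding casimir_eq_hessian[OF f] P_perp by (simp add: s_def p_def M_def n_def algebra_simps)
  qed
  have hc: "(\<Sum>j\<in>UNIV. h j \<bullet> c j) = s * (\<Sum>j\<in>UNIV. h j $ j)"
    using xh by (simp add: c_def P_def inner_diff_right inner_axis inner_commute[of _ x] sum_distrib_left)
  define HH where "HH = (\<Sum>j\<in>UNIV. h j \<bullet> h j)"
  have HH: "s\<^sup>2 * ((casimir f x)\<^sup>2 / (n - 1)) \<le> HH"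
  proof -
    \<comment> \<open>The multiple of \<open>P\<close> closest to the Hessian: \<open>t\<close>
      minimizes the quadratic expression below.\<close>
    define t where "t = casimir f x / (n - 1)"
    have "0 \<le> (\<Sum>j\<in>UNIV. (h j - t *\<^sub>R c j) \<bullet> (h j - t *\<^sub>R c j))"
      by (intro sum_nonneg) simp
    also have "\<dots> = HH - 2 * t * (\<Sum>j\<in>UNIV. h j \<bullet> c j) + t\<^sup>2 * (\<Sum>j\<in>UNIV. c j \<bullet> c j)"
      by (simp add: HH_def inner_diff_left inner_diff_right inner_commute[of "c _" "h _"] sum.distrib
          sum_subtractf sum_distrib_left power2_eq_square algebra_simps)
    also have "\<dots> = HH - s\<^sup>2 * ((casimir f x)\<^sup>2 / (n - 1))"
    proof -
      have "t * (n - 1) = casimir f x" using n by (simp add: t_def)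
      then have "t\<^sup>2 * ((n - 1) * s\<^sup>2) = t * casimir f x * s\<^sup>2"
        by (metis (no_types, opaque_lifting) mult.assoc power2_eq_square)
      moreover have "(casimir f x)\<^sup>2 / (n - 1) = t * casimir f x"
        by (simp add: t_def power2_eq_square)
      ultimately show ?thesis
        unfolding hc tr cc by (simp add: power2_eq_square algebra_simps)
    qed
    finally show ?thesis by simp
  qed
  have rot_P: "(\<Sum>i\<in>UNIV. \<Sum>j\<in>UNIV. (rot i j g x)\<^sup>2) = 2 / s * (P (gradient g x) \<bullet> P (gradient g x))" for g
    using s unfolding sum_rot_squared P_norm by (simp add: s_def euler_eq_inner)
  \<comment> \<open>The \<open>P Mx\<close> terms cancel by antisymmetry in \<open>k\<close> and
    \<open>l\<close>, and the terms with \<open>x \<bullet> p\<close> cancel between the two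
    wedges.\<close>
  have comp: "s * P (gradient (rot k l f) x) $ j = (c j $ k * z $ l - c j $ l * z $ k) + (x $ k * h j $ l - x $ l * h j $ k)"
    for k l j
  proof -
    have "P (gradient (rot k l f) x) = p $ l *\<^sub>R P (axis k 1) - p $ k *\<^sub>R P (axis l 1)
        + x $ k *\<^sub>R P (M l) - x $ l *\<^sub>R P (M k)"
      unfolding gradient_rot[OF f] p_def[symmetric] M_def[symmetric]
      by (simp add: P_def algebra_simps inner_diff_right inner_add_right)
    then have "P (gradient (rot k l f) x) $ j = p $ l * P (axis k 1) $ j - p $ k * P (axis l 1) $ j
        + x $ k * P (M l) $ j - x $ l * P (M k) $ j"
      by simp
    moreover have "z $ m = s * p $ m - (x \<bullet> p) * x $ m" for m
      by (simp add: z_def P_def)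
    ultimately show ?thesis
      by (simp only: c_nth) (simp add: h_def H_def algebra_simps)
  qed
  have "s\<^sup>2 * (\<Sum>k\<in>UNIV. \<Sum>l\<in>UNIV. P (gradient (rot k l f) x) \<bullet> P (gradient (rot k l f) x)) =
      (\<Sum>k\<in>UNIV. \<Sum>l\<in>UNIV. \<Sum>j\<in>UNIV. (s * P (gradient (rot k l f) x) $ j)\<^sup>2)"
    by (simp add: inner_vec_def sum_distrib_left power2_eq_square algebra_simps)
  also have "\<dots> = (\<Sum>k\<in>UNIV. \<Sum>j\<in>UNIV. \<Sum>l\<in>UNIV. (s * P (gradient (rot k l f) x) $ j)\<^sup>2)"
    by (intro sum.cong refl sum.swap)
  also have "\<dots> = (\<Sum>j\<in>UNIV. \<Sum>k\<in>UNIV. \<Sum>l\<in>UNIV. (s * P (gradient (rot k l f) x) $ j)\<^sup>2)"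
    by (rule sum.swap)
  also have "\<dots> = (\<Sum>j\<in>UNIV. 2 * (z \<bullet> z) * (c j \<bullet> c j) - 2 * s\<^sup>2 * (z $ j * z $ j) + 2 * s * (h j \<bullet> h j))"
  proof (intro sum.cong refl)
    fix j
    have "(\<Sum>k\<in>UNIV. \<Sum>l\<in>UNIV. (s * P (gradient (rot k l f) x) $ j)\<^sup>2) =
      (\<Sum>k\<in>UNIV. \<Sum>l\<in>UNIV. (c j $ k * z $ l - c j $ l * z $ k) * (c j $ k * z $ l - c j $ l * z $ k))
      + (\<Sum>k\<in>UNIV. \<Sum>l\<in>UNIV. (x $ k * h j $ l - x $ l * h j $ k) * (x $ k * h j $ l - x $ l * h j $ k))
      + 2 * (\<Sum>k\<in>UNIV. \<Sum>l\<in>UNIV. (c j $ k * z $ l - c j $ l * z $ k) * (x $ k * h j $ l - x $ l * h j $ k))"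
      unfolding comp power2_sum by (simp only: sum.distrib sum_distrib_left power2_eq_square mult.assoc)
    \<comment> \<open>The mixed sum vanishes, since \<open>c j\<close> and \<open>z\<close> are both
      orthogonal to \<open>x\<close>.\<close>
    also have "\<dots> = 2 * (z \<bullet> z) * (c j \<bullet> c j) - 2 * s\<^sup>2 * (z $ j * z $ j) + 2 * s * (h j \<bullet> h j)"
      unfolding wedge_sum using cx[of j] zx cz[of j] xh[of j]
      by (simp add: inner_commute[of "h j" x] inner_commute[of z "c j"] s_def[symmetric] power2_eq_square)
    finally show "(\<Sum>k\<in>UNIV. \<Sum>l\<in>UNIV. (s * P (gradient (rot k l f) x) $ j)\<^sup>2) =
      2 * (z \<bullet> z) * (c j \<bullet> c j) - 2 * s\<^sup>2 * (z $ j * z $ j) + 2 * s * (h j \<bullet> h j)" .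
  qed
  also have "\<dots> = 2 * (z \<bullet> z) * ((n - 1) * s\<^sup>2) - 2 * s\<^sup>2 * (z \<bullet> z) + 2 * s * HH"
    \<comment> \<open>The Ricci constant \<open>n - 2\<close> arises here: \<open>n - 1\<close> from
      \<open>cc\<close>, less 1 from \<open>cz\<close>.\<close>
    by (simp only: sum.distrib sum_subtractf sum_distrib_left[symmetric] cc HH_def inner_vec_def[of z z] inner_real_def)
  finally have total: "s\<^sup>2 * (\<Sum>k\<in>UNIV. \<Sum>l\<in>UNIV. P (gradient (rot k l f) x) \<bullet> P (gradient (rot k l f) x)) =
      2 * s\<^sup>2 * ((n - 2) * (z \<bullet> z)) + 2 * s * HH"
    by (simp add: algebra_simps)
  have "(1/4) * (\<Sum>k\<in>UNIV. \<Sum>l\<in>UNIV. \<Sum>i\<in>UNIV. \<Sum>j\<in>UNIV. (rot i j (rot k l f) x)\<^sup>2) =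
     1 / (2 * s) * (\<Sum>k\<in>UNIV. \<Sum>l\<in>UNIV. P (gradient (rot k l f) x) \<bullet> P (gradient (rot k l f) x))"
    unfolding rot_P by (simp add: sum_distrib_left[symmetric] sum_divide_distrib[symmetric])
  also have "\<dots> = 1 / (2 * s ^ 3) * (s\<^sup>2 * (\<Sum>k\<in>UNIV. \<Sum>l\<in>UNIV. P (gradient (rot k l f) x) \<bullet> P (gradient (rot k l f) x)))"
    using s by (simp add: power3_eq_cube power2_eq_square)
  also have "\<dots> = (n - 2) * ((z \<bullet> z) / s) + HH / s\<^sup>2"
    unfolding total using s by (simp add: field_simps power3_eq_cube power2_eq_square)
  also have "\<dots> \<ge> (n - 2) * ((z \<bullet> z) / s) + (casimir f x)\<^sup>2 / (n - 1)"
    using HH s by (simp add: pos_le_divide_eq mult.commute)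
  finally show ?thesis
    unfolding rot_P z_def p_def n_def by (simp add: algebra_simps)
qed

subsection \<open>Integration by parts against the weight \<open>|x|\<^sup>-\<^sup>4\<close>\<close>

text \<open>On the \<open>k\<close>-th dyadic annulus the integrand grows like \<open>4 ^ k\<close>,
  while the volume of the ball decays at least like \<open>8 ^ k\<close> in dimension at least 3.
  The bounds form a geometric series of ratio 1/2.\<close>

lemma integrable_inverse_norm_squared:
  assumes "DIM('a::euclidean_space) \<ge> 3"
  shows "integrable lborel (\<lambda>x::'a. indicator (cball 0 R) x / (norm x)\<^sup>2)"
proof (cases "R > 0")
  case False
  then have "(\<lambda>x::'a. indicator (cball 0 R) x / (norm x)\<^sup>2) = (\<lambda>x. 0 :: real)"
    by (auto simp: indicator_def fun_eq_iff) (meson linorder_not_less norm_le_zero_iff order_trans)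
  then show ?thesis by simp
next
  case R: True
  define V where "V = unit_ball_vol (DIM('a)) * R ^ DIM('a) * (4 / R\<^sup>2)"
  have V: "V \<ge> 0" using R by (simp add: V_def)
  \<comment> \<open>Decompose the ball into dyadic annuli.\<close>
  have pt: "ennreal (indicator (cball 0 R) x / (norm x)\<^sup>2) \<le>
      (\<Sum>k. ennreal (4 ^ Suc k / R\<^sup>2) * indicator (cball 0 (R / 2 ^ k)) x)" (is "_ \<le> suminf ?g") for x :: 'a
  proof (cases "x \<noteq> 0 \<and> norm x \<le> R")
    case True
    obtain m where "(1/2) ^ m < norm x / R"
      using real_arch_pow_inv[of "norm x / R" "1/2"] True R by auto
    then have "R / 2 ^ m < norm x"
      using R by (simp add: power_one_over field_simps)
    \<comment> \<open>The least such index places \<open>x\<close> in one annulus; it is not 0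
      because \<open>norm x \<le> R\<close>.\<close>
    define m where "m = (LEAST m. R / 2 ^ m < norm x)"
    have m: "R / 2 ^ m < norm x"
      unfolding m_def by (rule LeastI) fact
    have "m \<noteq> 0" using m True by (auto intro: ccontr)
    then obtain k where k: "m = Suc k" by (cases m) auto
    have "\<not> R / 2 ^ k < norm x"
      using not_less_Least[of k "\<lambda>m. R / 2 ^ m < norm x"] k by (simp add: m_def)
    then have x: "x \<in> cball 0 (R / 2 ^ k)" by simp
    have "(R / 2 ^ Suc k)\<^sup>2 \<le> (norm x)\<^sup>2"
      using m R by (intro power_mono) (auto simp: k)
    moreover have "(R / 2 ^ Suc k)\<^sup>2 = R\<^sup>2 / 4 ^ Suc k"
      by (simp add: power_divide power_mult_distrib power2_eq_square flip: power_mult_distrib)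
    ultimately have "R\<^sup>2 / 4 ^ Suc k \<le> (norm x)\<^sup>2" by simp
    then have "1 / (norm x)\<^sup>2 \<le> 1 / (R\<^sup>2 / 4 ^ Suc k)"
      using R by (intro divide_left_mono) (use True in auto)
    then have "ennreal (indicator (cball 0 R) x / (norm x)\<^sup>2) \<le> ?g k"
      using True x by (simp add: indicator_def ennreal_leI)
    also have "\<dots> \<le> suminf ?g"
      using ennreal_suminf_lessD[of ?g "?g k" k] by (meson less_irrefl not_le)
    finally show ?thesis .
  qed (auto simp: indicator_def)
  have "(\<integral>\<^sup>+x. ennreal (indicator (cball 0 R) (x::'a) / (norm x)\<^sup>2) \<partial>lborel) \<le>
      (\<integral>\<^sup>+x. (\<Sum>k. ennreal (4 ^ Suc k / R\<^sup>2) * indicator (cball 0 (R / 2 ^ k)) (x::'a)) \<partial>lborel)"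
    by (intro nn_integral_mono pt)
  also have "\<dots> = (\<Sum>k. ennreal (4 ^ Suc k / R\<^sup>2) * emeasure lborel (cball (0::'a) (R / 2 ^ k)))"
    by (subst nn_integral_suminf) (measurable, simp_all add: nn_integral_cmult_indicator)
  also have "\<dots> \<le> (\<Sum>k. ennreal (V * (1/2) ^ k))"
  proof (intro suminf_le summableI)
    fix k
    have "4 ^ Suc k / R\<^sup>2 * (unit_ball_vol (DIM('a)) * (R / 2 ^ k) ^ DIM('a)) = V * (4 ^ k * ((1/2) ^ k) ^ DIM('a))"
      by (simp add: V_def power_divide field_simps)
    also have "\<dots> \<le> V * (4 ^ k * ((1/2) ^ k) ^ 3)"
      using V assms by (intro mult_left_mono power_decreasing) (auto simp: power_le_one)
    also have "\<dots> = V * (1/2) ^ k"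
    proof -
      have "(4::real) ^ k = 2 ^ k * 2 ^ k" by (simp flip: power_mult_distrib)
      then show ?thesis by (simp add: power3_eq_cube power_one_over)
    qed
    finally have "4 ^ Suc k / R\<^sup>2 * (unit_ball_vol (DIM('a)) * (R / 2 ^ k) ^ DIM('a)) \<le> V * (1/2) ^ k" .
    then show "ennreal (4 ^ Suc k / R\<^sup>2) * emeasure lborel (cball (0::'a) (R / 2 ^ k)) \<le> ennreal (V * (1/2) ^ k)"
      using R by (subst emeasure_cball) (auto simp: ennreal_mult[symmetric] ennreal_leI)
  qed
  also have "\<dots> < \<infinity>"
  proof -
    have "summable (\<lambda>k. V * (1/2) ^ k)"
      by (intro summable_mult summable_geometric) simp
    then have "(\<Sum>k. ennreal (V * (1/2) ^ k)) \<noteq> top"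
      using V by (intro ennreal_suminf_neq_top) simp_all
    then show ?thesis by (simp add: less_top)
  qed
  finally show ?thesis
    by (intro integrableI_bounded) (auto simp: indicator_def)
qed

section \<open>Integrals of compactly supported functions and of their derivatives\<close>

lemma integrable_continuous_bounded_support:
  fixes f :: "'a::euclidean_space \<Rightarrow> real"
  assumes "continuous_on UNIV f" "\<And>x. R < norm x \<Longrightarrow> f x = 0"
  shows "integrable lborel f"
proof -
  have "integrable lborel (\<lambda>x. indicator (cball 0 R) x *\<^sub>R f x)"
    using assms(1) by (intro borel_integrable_compact) (auto intro: continuous_on_subset)
  moreover have "(\<lambda>x. indicator (cball 0 R) x *\<^sub>R f x) = f"
    using assms(2) by (auto simp: indicator_def fun_eq_iff)
  ultimately show ?thesis by simp
qed

lemma bounded_continuous_bounded_support: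
  fixes f :: "'a::euclidean_space \<Rightarrow> real"
  assumes "continuous_on UNIV f" "\<And>x. R < norm x \<Longrightarrow> f x = 0"
  shows "\<exists>B\<ge>0. \<forall>x. \<bar>f x\<bar> \<le> B"
proof -
  have "bounded (f ` cball 0 R)"
    using assms(1) by (intro compact_imp_bounded compact_continuous_image) (auto intro: continuous_on_subset)
  then obtain B where B: "\<And>x. norm x \<le> R \<Longrightarrow> \<bar>f x\<bar> \<le> B"
    unfolding bounded_iff by (metis image_eqI mem_cball_0 real_norm_def)
  have "\<bar>f x\<bar> \<le> max B 0" for x
    using B[of x] assms(2)[of x] by (cases "norm x \<le> R") auto
  then show ?thesis by (intro exI[of _ "max B 0"]) auto
qed

lemma lborel_integral_translation:
  fixes f :: "'a::euclidean_space \<Rightarrow> real"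
  assumes "f \<in> borel_measurable borel"
  shows "integral\<^sup>L lborel (\<lambda>x. f (x + a)) = integral\<^sup>L lborel f"
    and "integrable lborel f \<Longrightarrow> integrable lborel (\<lambda>x. f (x + a))"
proof -
  have "integral\<^sup>L (distr lborel borel ((+) a)) f = integral\<^sup>L lborel (\<lambda>x. f (a + x))"
    using assms by (intro integral_distr) auto
  then show "integral\<^sup>L lborel (\<lambda>x. f (x + a)) = integral\<^sup>L lborel f"
    by (simp add: lborel_distr_plus add.commute)
  have "integrable (distr lborel borel ((+) a)) f \<longleftrightarrow> integrable lborel (\<lambda>x. f (a + x))"
    using assms by (intro integrable_distr_eq) auto
  then show "integrable lborel f \<Longrightarrow> integrable lborel (\<lambda>x. f (x + a))"
    by (simp add: lborel_distr_plus add.commute)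
qed

text \<open>Difference quotients have integral 0, since a translate of \<open>f\<close> has the same
  integral, and they converge dominatedly to the derivative.\<close>

lemma integral_partial_deriv:
  fixes f :: "real^'n::finite \<Rightarrow> real"
  assumes diff: "\<And>x. f differentiable at x" and cont: "continuous_on UNIV (partial_deriv i f)"
    and supp: "\<And>x. R < norm x \<Longrightarrow> f x = 0"
  shows "integral\<^sup>L lborel (partial_deriv i f) = 0"
proof -
  have contf: "continuous_on UNIV f"
    using diff by (simp add: differentiable_imp_continuous_on differentiable_on_def)
  have int: "integrable lborel f"
    by (rule integrable_continuous_bounded_support[OF contf supp])
  have supp': "\<And>x. R < norm x \<Longrightarrow> partial_deriv i f x = 0"
    using partial_deriv_zero_outside[OF supp] .
  obtain B where B: "B \<ge> 0" "\<And>x. \<bar>partial_deriv i f x\<bar> \<le> B"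
    using bounded_continuous_bounded_support[OF cont supp'] by blast
  define e where "e = (axis i 1 :: real^'n)"
  define h where "h m = inverse (real (Suc m))" for m
  have h: "0 < h m" "h m \<le> 1" for m by (simp_all add: h_def inverse_le_1_iff)
  have D: "DERIV (\<lambda>t. f (x + t *\<^sub>R e)) t :> partial_deriv i f (x + t *\<^sub>R e)" for x t
    using DERIV_along_line[OF diff] by (simp add: partial_deriv_def e_def)
  define s where "s m x = (f (x + h m *\<^sub>R e) - f x) / h m" for m x
  have [measurable]: "f \<in> borel_measurable borel"
    using contf by (rule borel_measurable_continuous_onI)
  \<comment> \<open>Translation invariance of the Lebesgue measure.\<close>
  have int_s: "integral\<^sup>L lborel (s m) = 0" for m
    unfolding s_def using int lborel_integral_translation[of f "h m *\<^sub>R e"] by simp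
  have lim: "(\<lambda>m. s m x) \<longlonglongrightarrow> partial_deriv i f x" for x
  proof -
    have "h \<longlonglongrightarrow> 0" unfolding h_def by (rule LIMSEQ_inverse_real_of_nat)
    then have "filterlim h (at 0) sequentially"
      using h(1) by (intro filterlim_atI) (auto simp: less_imp_neq[symmetric])
    moreover have "((\<lambda>t. (f (x + t *\<^sub>R e) - f x) / t) \<longlongrightarrow> partial_deriv i f x) (at 0)"
      using D[of x 0] by (simp add: DERIV_def)
    ultimately show ?thesis
      unfolding s_def by (rule filterlim_compose[rotated])
  qed
  \<comment> \<open>The radius grows by 1 because \<open>h m \<le> 1\<close>: the mean value point
    lies within distance 1 of \<open>x\<close>.\<close>
  have bound: "norm (s m x) \<le> B * indicator (cball 0 (R + 1)) x" for m x
  proof -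
    obtain z where z: "0 < z" "z < h m" "f (x + h m *\<^sub>R e) - f (x + 0 *\<^sub>R e) = (h m - 0) * partial_deriv i f (x + z *\<^sub>R e)"
      using MVT2[OF h(1)[of m] D[of x]] by blast
    then have s: "s m x = partial_deriv i f (x + z *\<^sub>R e)"
      using h(1)[of m] by (simp add: s_def)
    show ?thesis
    proof (cases "norm x \<le> R + 1")
      case True
      then show ?thesis using B by (simp add: s)
    next
      case False
      have "norm x \<le> norm (x + z *\<^sub>R e) + norm (z *\<^sub>R e)"
        using norm_triangle_ineq4[of "x + z *\<^sub>R e" "z *\<^sub>R e"] by simp
      moreover have "norm (z *\<^sub>R e) \<le> 1"
        using z h(2)[of m] by (simp add: e_def)
      ultimately have "R < norm (x + z *\<^sub>R e)" using False by simp
      then show ?thesis using supp' False by (simp add: s)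
    qed
  qed
  have "(\<lambda>m. integral\<^sup>L lborel (s m)) \<longlonglongrightarrow> integral\<^sup>L lborel (partial_deriv i f)"
  proof (rule integral_dominated_convergence)
    show "partial_deriv i f \<in> borel_measurable lborel"
      using borel_measurable_continuous_onI[OF cont] by simp
    show "s m \<in> borel_measurable lborel" for m
      unfolding s_def by measurable
    show "integrable lborel (\<lambda>x::real^'n. B * indicator (cball 0 (R + 1)) x)"
      using emeasure_lborel_cball_finite by (intro integrable_mult_right integrable_real_indicator) auto
  qed (use lim bound in auto)
  then show ?thesis by (simp add: int_s LIMSEQ_const_iff)
qed

text \<open>Vanishing at the origin gives a bound \<open>C * norm x\<close>, so products against the
  weight are of order \<open>1 / (norm x)\<^sup>2\<close> there and integrable in dimension at least
  3. \<open>rot\<close>, \<open>euler\<close> and \<open>casimir\<close> map test functions into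
  this class.\<close>

definition test0 :: "('a::real_normed_vector \<Rightarrow> real) set" where
  "test0 = {f \<in> test_functions. f 0 = 0}"

text \<open>For a function of the form \<open>(x \<bullet> x) * g x\<close> the weight cancels,
  leaving the plain L2 norm of \<open>g\<close>.\<close>

definition weighted_inner :: "('a::euclidean_space \<Rightarrow> real) \<Rightarrow> ('a \<Rightarrow> real) \<Rightarrow> real" where
  "weighted_inner f g = (\<integral>x. f x * g x / norm x ^ 4 \<partial>lborel)"

lemma test0D: "f \<in> test0 \<Longrightarrow> f \<in> test_functions" "f \<in> test0 \<Longrightarrow> smooth f" "f \<in> test0 \<Longrightarrow> f 0 = 0"
  by (auto simp: test0_def test_functions_def)

lemma test_functions_bounded:
  fixes f :: "'a::euclidean_space \<Rightarrow> real"
  assumes "f \<in> test_functions" shows "\<exists>B\<ge>0. \<forall>x. \<bar>f x\<bar> \<le> B"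
  using assms bounded_continuous_bounded_support smooth_continuous
  unfolding test_functions_iff by blast

lemma test0_linear_bound:
  fixes f :: "real^'n::finite \<Rightarrow> real"
  assumes f: "f \<in> test0"
  shows "\<exists>C\<ge>0. \<forall>x. \<bar>f x\<bar> \<le> C * norm x"
proof -
  have "\<forall>i. \<exists>B\<ge>0. \<forall>x. \<bar>partial_deriv i f x\<bar> \<le> B"
    using f by (auto intro!: test_functions_bounded test_functions_partial simp: test0_def)
  then obtain B where B: "\<And>i. B i \<ge> 0" "\<And>i x. \<bar>partial_deriv i f x\<bar> \<le> B i"
    by metis
  define C where "C = (\<Sum>i\<in>UNIV. B i)"
  have "norm (gradient f x) \<le> C" for x
  proof -
    have "norm (gradient f x) \<le> (\<Sum>i\<in>UNIV. \<bar>gradient f x $ i\<bar>)"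
      by (rule norm_le_l1_cart)
    also have "\<dots> \<le> C"
      unfolding C_def using B(2) by (intro sum_mono) (simp add: gradient_def)
    finally show ?thesis .
  qed
  then have on: "onorm (\<lambda>h. h \<bullet> gradient f x) \<le> C" for x
    by (intro onorm_le) (metis mult.commute mult_right_mono norm_ge_zero order_trans Cauchy_Schwarz_ineq2 real_norm_def)
  have "norm (f x - f 0) \<le> C * norm (x - 0)" for x
  proof (rule differentiable_bound[of UNIV f "\<lambda>x h. h \<bullet> gradient f x"])
    show "(f has_derivative (\<lambda>h. h \<bullet> gradient f y)) (at y within UNIV)" for y
      using GDERIV_gradient[OF smooth_differentiable[OF test0D(2)[OF f]]] by (simp add: gderiv_def)
  qed (use on in auto)
  moreover have "C \<ge> 0" using B(1) by (simp add: C_def sum_nonneg)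
  ultimately show ?thesis using test0D(3)[OF f] by (intro exI[of _ C]) auto
qed

lemma test_functions_measurable:
  fixes f :: "'a::euclidean_space \<Rightarrow> real"
  shows "f \<in> test_functions \<Longrightarrow> f \<in> borel_measurable borel"
  by (intro borel_measurable_continuous_onI smooth_continuous test_functions_smooth)

lemma integrable_weighted_inner:
  fixes f g :: "real^'n::finite \<Rightarrow> real"
  assumes N: "CARD('n) \<ge> 3" and f: "f \<in> test0" and g: "g \<in> test0"
  shows "integrable lborel (\<lambda>x. f x * g x / norm x ^ 4)"
proof -
  obtain C where C: "C \<ge> 0" "\<And>x. \<bar>f x\<bar> \<le> C * norm x" using test0_linear_bound[OF f] by blast
  obtain C' where C': "C' \<ge> 0" "\<And>x. \<bar>g x\<bar> \<le> C' * norm x" using test0_linear_bound[OF g] by blast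
  obtain R where R: "\<And>x. R < norm x \<Longrightarrow> f x = 0"
    using f by (auto simp: test0_def test_functions_iff)
  have [measurable]: "f \<in> borel_measurable borel" "g \<in> borel_measurable borel"
    using f g by (auto simp: test0_def test_functions_measurable)
  have int: "integrable lborel (\<lambda>x::real^'n. (C * C') * (indicator (cball 0 R) x / (norm x)\<^sup>2))"
    using N by (intro integrable_mult_right integrable_inverse_norm_squared) simp
  show ?thesis
  proof (rule Bochner_Integration.integrable_bound[OF int])
    have "norm (f x * g x / norm x ^ 4) \<le> (C * C') * (indicator (cball 0 R) x / (norm x)\<^sup>2)" for x
    proof (cases "norm x \<le> R \<and> x \<noteq> 0")
      case True
      have "\<bar>f x\<bar> * \<bar>g x\<bar> \<le> (C * norm x) * (C' * norm x)"
        using C C' by (intro mult_mono) auto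
      then have "\<bar>f x\<bar> * \<bar>g x\<bar> / norm x ^ 4 \<le> (C * norm x) * (C' * norm x) / norm x ^ 4"
        by (rule divide_right_mono) simp
      also have "\<dots> = (C * C') * (1 / (norm x)\<^sup>2)"
        using True by (simp add: power2_eq_square power4_eq_xxxx)
      finally show ?thesis using True by (simp add: abs_mult)
    next
      case False
      then show ?thesis using R C C' by (cases "x = 0") auto
    qed
    then show "AE x in lborel. norm (f x * g x / norm x ^ 4) \<le> norm ((C * C') * (indicator (cball 0 R) x / (norm x)\<^sup>2))"
      using C C' by (intro AE_I2) (simp add: abs_mult)
  qed measurable
qed

lemma test0_add: "f \<in> test0 \<Longrightarrow> g \<in> test0 \<Longrightarrow> (\<lambda>x. f x + g x) \<in> test0"
  for f :: "'a::euclidean_space \<Rightarrow> real"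
  by (auto simp: test0_def test_functions_add)

lemma test0_cmult: "f \<in> test0 \<Longrightarrow> (\<lambda>x. c * f x) \<in> test0"
  for f :: "'a::euclidean_space \<Rightarrow> real"
  by (auto simp: test0_def test_functions_mult_smooth)

lemma test0_sum: "(\<And>i. i \<in> I \<Longrightarrow> f i \<in> test0) \<Longrightarrow> (\<lambda>x. \<Sum>i\<in>I. f i x) \<in> test0"
  for f :: "'i \<Rightarrow> 'a::euclidean_space \<Rightarrow> real"
  by (auto simp: test0_def test_functions_sum)

lemma test0_rot: "f \<in> test_functions \<Longrightarrow> rot i j f \<in> test0"
  using test_functions_rot[of f i j] by (simp add: test0_def rot_def)

lemma test0_euler: "f \<in> test_functions \<Longrightarrow> euler f \<in> test0"
  using test_functions_euler[of f] by (simp add: test0_def euler_def)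

lemma test0_casimir: "f \<in> test_functions \<Longrightarrow> casimir f \<in> test0"
  using test_functions_casimir[of f] by (simp add: test0_def casimir_def rot_def)

section \<open>Regularized weights and antisymmetry of the fields\<close>

lemma partial_regularized_weight:
  fixes f :: "real^'n::finite \<Rightarrow> real"
  assumes f: "f differentiable at x" and e: "e > 0"
  shows "(\<lambda>x. x $ j * (inverse ((x \<bullet> x + e)\<^sup>2) * f x)) differentiable at x"
    and "partial_deriv i (\<lambda>x. x $ j * (inverse ((x \<bullet> x + e)\<^sup>2) * f x)) x =
      (if i = j then inverse ((x \<bullet> x + e)\<^sup>2) * f x else 0)
      + x $ j * (inverse ((x \<bullet> x + e)\<^sup>2) * partial_deriv i f x - 4 * inverse ((x \<bullet> x + e) ^ 3) * x $ i * f x)"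
proof -
  have pos: "x \<bullet> x + e > 0" using e by (simp add: add_nonneg_pos)
  have D: "((\<lambda>x. inverse ((x \<bullet> x + e)\<^sup>2)) has_derivative (\<lambda>h. - 4 * (x \<bullet> h) * inverse ((x \<bullet> x + e) ^ 3))) (at x)"
  proof -
    have "((\<lambda>y::real. inverse (y\<^sup>2)) has_field_derivative - 2 * inverse (y ^ 3)) (at y)" if "y > 0" for y
      using that by (auto intro!: derivative_eq_intros simp: field_simps power2_eq_square power3_eq_cube)
    from this[OF pos]
    have 1: "((\<lambda>y::real. inverse (y\<^sup>2)) has_derivative (\<lambda>h. - 2 * inverse ((x \<bullet> x + e) ^ 3) * h)) (at (x \<bullet> x + e))"
      unfolding has_field_derivative_def .
    have 2: "((\<lambda>x. x \<bullet> x + e) has_derivative (\<lambda>h. 2 * (x \<bullet> h))) (at x)"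
      by (auto intro!: derivative_eq_intros simp: inner_commute)
    show ?thesis
      using has_derivative_compose[OF 2 1] by (simp add: mult_ac)
  qed
  then have dw: "(\<lambda>x. inverse ((x \<bullet> x + e)\<^sup>2)) differentiable at x"
    by (auto simp: differentiable_def)
  have pw: "partial_deriv i (\<lambda>x. inverse ((x \<bullet> x + e)\<^sup>2)) x = - 4 * x $ i * inverse ((x \<bullet> x + e) ^ 3)"
    unfolding partial_deriv_def by (subst frechet_derivative_at[OF D, symmetric]) (simp add: inner_axis)
  have dp: "(\<lambda>x. inverse ((x \<bullet> x + e)\<^sup>2) * f x) differentiable at x"
    by (intro differentiable_mult dw f)
  have dx: "(\<lambda>x::real^'n. x $ j) differentiable at x"
    by (intro smooth_differentiable smooth_component)
  show "(\<lambda>x. x $ j * (inverse ((x \<bullet> x + e)\<^sup>2) * f x)) differentiable at x"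
    by (intro differentiable_mult dx dp)
  show "partial_deriv i (\<lambda>x. x $ j * (inverse ((x \<bullet> x + e)\<^sup>2) * f x)) x =
      (if i = j then inverse ((x \<bullet> x + e)\<^sup>2) * f x else 0)
      + x $ j * (inverse ((x \<bullet> x + e)\<^sup>2) * partial_deriv i f x - 4 * inverse ((x \<bullet> x + e) ^ 3) * x $ i * f x)"
    unfolding partial_deriv_mult[OF dx dp] partial_deriv_mult[OF dw f] pw partial_deriv_component
    by (simp add: algebra_simps)
qed

text \<open>With \<open>e > 0\<close> the weight is differentiable at the origin too, so
  \<open>integral_partial_deriv\<close> applies. \<open>q i j\<close> is the expanded derivative;
  rotations use differences of these, the dilation field the diagonal sum.\<close>

lemma integral_partial_regularized:
  fixes f :: "real^'n::finite \<Rightarrow> real"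
  assumes f: "f \<in> test_functions" and e: "e > 0"
  defines "q \<equiv> \<lambda>i j x. (if i = j then inverse ((x \<bullet> x + e)\<^sup>2) * f x else 0)
      + x $ j * (inverse ((x \<bullet> x + e)\<^sup>2) * partial_deriv i f x - 4 * inverse ((x \<bullet> x + e) ^ 3) * x $ i * f x)"
  shows "integrable lborel (q i j)" "integral\<^sup>L lborel (q i j) = 0"
proof -
  obtain R where R: "\<And>x. R < norm x \<Longrightarrow> f x = 0"
    using f by (auto simp: test_functions_iff)
  have df: "f differentiable at x" for x
    using f by (intro smooth_differentiable test_functions_smooth)
  define g where "g = (\<lambda>x. x $ j * (inverse ((x \<bullet> x + e)\<^sup>2) * f x))"
  have q: "partial_deriv i g = q i j"
    unfolding g_def q_def using partial_regularized_weight(2)[OF df e] by blast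
  have nz: "x \<bullet> x + e \<noteq> 0" for x :: "real^'n"
    using e by (metis add_nonneg_pos inner_ge_zero less_irrefl)
  have cf: "continuous_on UNIV f" "continuous_on UNIV (partial_deriv i f)"
    using smooth_continuous smooth_partial test_functions_smooth[OF f] by blast+
  have c: "continuous_on UNIV (q i j)"
    unfolding q_def using nz cf by (cases "i = j") (auto intro!: continuous_intros)
  have g0: "\<And>x. R < norm x \<Longrightarrow> g x = 0" using R by (simp add: g_def)
  have dg: "g differentiable at x" for x
    unfolding g_def by (rule partial_regularized_weight(1)[OF df e])
  show "integral\<^sup>L lborel (q i j) = 0"
    using integral_partial_deriv[OF dg _ g0, of i] c by (simp add: q)
  have "q i j x = 0" if "R < norm x" for x
    using partial_deriv_zero_outside[of R g x i, OF g0 that] by (simp add: q)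
  then show "integrable lborel (q i j)"
    by (rule integrable_continuous_bounded_support[OF c])
qed

text \<open>In the difference of the (j, i) and (i, j) identities the terms from differentiating the
  radial weight are symmetric and cancel.\<close>

lemma integral_rot_regularized:
  fixes f :: "real^'n::finite \<Rightarrow> real"
  assumes f: "f \<in> test_functions" and e: "e > 0"
  shows "(\<integral>x. inverse ((x \<bullet> x + e)\<^sup>2) * rot i j f x \<partial>lborel) = 0"
proof (cases "i = j")
  case True
  then show ?thesis by (simp add: rot_def)
next
  case False
  note I = integral_partial_regularized[OF f e]
  show ?thesis
    using Bochner_Integration.integral_diff[OF I(1)[of j i] I(1)[of i j]] I(2)[of i j] I(2)[of j i] False
    by (simp add: rot_def algebra_simps)
qed

text \<open>The divergence theorem for the field \<open>x\<close> times weight times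
  \<open>f\<close>.\<close>

lemma integral_euler_regularized:
  fixes f :: "real^'n::finite \<Rightarrow> real"
  assumes f: "f \<in> test_functions" and e: "e > 0"
  shows "(\<integral>x. inverse ((x \<bullet> x + e)\<^sup>2) * (euler f x + real CARD('n) * f x)
    - 4 * (x \<bullet> x) * inverse ((x \<bullet> x + e) ^ 3) * f x \<partial>lborel) = 0"
proof -
  note I = integral_partial_regularized[OF f e]
  have "inverse ((x \<bullet> x + e)\<^sup>2) * (euler f x + real CARD('n) * f x)
    - 4 * (x \<bullet> x) * inverse ((x \<bullet> x + e) ^ 3) * f x =
    (\<Sum>i\<in>UNIV. (if i = i then inverse ((x \<bullet> x + e)\<^sup>2) * f x else 0)
      + x $ i * (inverse ((x \<bullet> x + e)\<^sup>2) * partial_deriv i f x - 4 * inverse ((x \<bullet> x + e) ^ 3) * x $ i * f x))" for x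
    by (simp add: sum.distrib right_diff_distrib sum_subtractf euler_def inner_vec_def[of x x]
        sum_distrib_left sum_distrib_right distrib_left mult_ac del: inner_real_def)
       (simp add: mult_ac)
  then show ?thesis
    using I by (simp only: Bochner_Integration.integral_sum[OF I(1)] I(2)) simp
qed

text \<open>Dominated convergence with the limit itself as majorant, since \<open>g m\<close> lies
  below the singular weight. At the origin, where division by 0 gives 0, the bound on
  \<open>g m\<close> is replaced by \<open>\<psi> 0 = 0\<close>.\<close>

lemma weighted_integral_limit:
  fixes \<psi> :: "'a::euclidean_space \<Rightarrow> real" and g :: "nat \<Rightarrow> 'a \<Rightarrow> real"
  assumes [measurable]: "\<psi> \<in> borel_measurable borel" "\<And>m. g m \<in> borel_measurable borel"
    and int: "integrable lborel (\<lambda>x. \<psi> x / norm x ^ 4)" and zero: "\<psi> 0 = 0"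
    and nonneg: "\<And>m x. 0 \<le> g m x" and le: "\<And>m x. x \<noteq> 0 \<Longrightarrow> g m x \<le> 1 / norm x ^ 4"
    and lim: "\<And>x. x \<noteq> 0 \<Longrightarrow> (\<lambda>m. g m x) \<longlonglongrightarrow> 1 / norm x ^ 4"
  shows "(\<lambda>m. \<integral>x. g m x * \<psi> x \<partial>lborel) \<longlonglongrightarrow> (\<integral>x. \<psi> x / norm x ^ 4 \<partial>lborel)"
    and "integrable lborel (\<lambda>x. g m x * \<psi> x)"
proof -
  have L: "(\<lambda>m. g m x * \<psi> x) \<longlonglongrightarrow> \<psi> x / norm x ^ 4" for x
    using tendsto_mult_right[OF lim, of x "\<psi> x"] zero by (cases "x = 0") auto
  have B: "norm (g m x * \<psi> x) \<le> \<bar>\<psi> x / norm x ^ 4\<bar>" for m x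
  proof (cases "x = 0")
    case False
    have "g m x * \<bar>\<psi> x\<bar> \<le> 1 / norm x ^ 4 * \<bar>\<psi> x\<bar>"
      using le[OF False] by (rule mult_right_mono) simp
    then show ?thesis using nonneg by (simp add: abs_mult)
  qed (simp add: zero)
  have m: "(\<lambda>x. \<psi> x / norm x ^ 4) \<in> borel_measurable lborel" "(\<lambda>x. g m x * \<psi> x) \<in> borel_measurable lborel" for m
    by measurable
  note dct = m integrable_abs[OF int] AE_I2[OF L] AE_I2[OF B]
  show "(\<lambda>m. \<integral>x. g m x * \<psi> x \<partial>lborel) \<longlonglongrightarrow> (\<integral>x. \<psi> x / norm x ^ 4 \<partial>lborel)"
    by (rule integral_dominated_convergence[OF dct])
  show "integrable lborel (\<lambda>x. g m x * \<psi> x)"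
    by (rule integrable_dominated_convergence2[OF dct])
qed

lemma regularized_weights:
  fixes x :: "'a::euclidean_space"
  defines "s \<equiv> x \<bullet> x" and "e \<equiv> \<lambda>m. inverse (real (Suc m))"
  shows "0 \<le> inverse ((s + e m)\<^sup>2)" "0 \<le> s * inverse ((s + e m) ^ 3)"
    "x \<noteq> 0 \<Longrightarrow> inverse ((s + e m)\<^sup>2) \<le> 1 / norm x ^ 4"
    "x \<noteq> 0 \<Longrightarrow> s * inverse ((s + e m) ^ 3) \<le> 1 / norm x ^ 4"
    "x \<noteq> 0 \<Longrightarrow> (\<lambda>m. inverse ((s + e m)\<^sup>2)) \<longlonglongrightarrow> 1 / norm x ^ 4"
    "x \<noteq> 0 \<Longrightarrow> (\<lambda>m. s * inverse ((s + e m) ^ 3)) \<longlonglongrightarrow> 1 / norm x ^ 4"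
proof -
  have e: "e m > 0" for m by (simp add: e_def)
  have s: "s \<ge> 0" by (simp add: s_def)
  have n: "norm x ^ 4 = s\<^sup>2"
    by (simp add: s_def power2_norm_eq_inner[symmetric] flip: power_mult)
  show "0 \<le> inverse ((s + e m)\<^sup>2)" "0 \<le> s * inverse ((s + e m) ^ 3)"
    using s e[of m] by auto
  assume "x \<noteq> 0"
  then have s: "s > 0" by (simp add: s_def)
  have "inverse ((s + e m)\<^sup>2) \<le> inverse (s\<^sup>2)"
    using s e[of m] by (intro le_imp_inverse_le power_mono) auto
  then show le: "inverse ((s + e m)\<^sup>2) \<le> 1 / norm x ^ 4"
    by (simp add: n inverse_eq_divide)
  have "s * inverse ((s + e m) ^ 3) \<le> (s + e m) * inverse ((s + e m) ^ 3)"
    using s e[of m] by (intro mult_right_mono) auto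
  also have "\<dots> = inverse ((s + e m)\<^sup>2)"
    using s e[of m] by (simp add: power3_eq_cube power2_eq_square)
  finally show "s * inverse ((s + e m) ^ 3) \<le> 1 / norm x ^ 4"
    using le by simp
  have E: "e \<longlonglongrightarrow> 0" unfolding e_def by (rule LIMSEQ_inverse_real_of_nat)
  have "(\<lambda>m. inverse ((s + e m)\<^sup>2)) \<longlonglongrightarrow> inverse ((s + 0)\<^sup>2)"
    using s by (intro tendsto_intros E) auto
  then show "(\<lambda>m. inverse ((s + e m)\<^sup>2)) \<longlonglongrightarrow> 1 / norm x ^ 4"
    by (simp add: n inverse_eq_divide)
  have "(\<lambda>m. s * inverse ((s + e m) ^ 3)) \<longlonglongrightarrow> s * inverse ((s + 0) ^ 3)"
    using s by (intro tendsto_intros E) auto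
  moreover have "s * inverse ((s + 0) ^ 3) = 1 / norm x ^ 4"
    using s by (simp add: n power3_eq_cube power2_eq_square inverse_eq_divide)
  ultimately show "(\<lambda>m. s * inverse ((s + e m) ^ 3)) \<longlonglongrightarrow> 1 / norm x ^ 4"
    by simp
qed

lemma rot_mult:
  "smooth f \<Longrightarrow> smooth g \<Longrightarrow> rot i j (\<lambda>x. f x * g x) x = f x * rot i j g x + rot i j f x * g x"
  by (simp add: rot_def partial_simps algebra_simps)

lemma euler_mult:
  "smooth f \<Longrightarrow> smooth g \<Longrightarrow> euler (\<lambda>x. f x * g x) x = f x * euler g x + euler f x * g x"
  by (simp add: euler_def partial_simps distrib_left sum.distrib sum_distrib_left sum_distrib_right mult_ac)

text \<open>\<open>rot i j\<close> of the product \<open>f x * g x\<close> integrates to 0 against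
  each regularized weight, hence also in the limit.\<close>

lemma weighted_inner_rot:
  fixes f g :: "real^'n::finite \<Rightarrow> real"
  assumes N: "CARD('n) \<ge> 3" and f: "f \<in> test0" and g: "g \<in> test0"
  shows "weighted_inner (rot i j f) g = - weighted_inner f (rot i j g)"
proof -
  let ?w = "\<lambda>m (x::real^'n). inverse ((x \<bullet> x + inverse (real (Suc m)))\<^sup>2)"
  define \<psi> where "\<psi> = rot i j (\<lambda>x. f x * g x)"
  have tf: "(\<lambda>x. f x * g x) \<in> test_functions"
    by (intro test_functions_mult_smooth test0D(2)[OF f] test0D(1)[OF g])
  have \<psi>: "\<psi> x = f x * rot i j g x + rot i j f x * g x" for x
    unfolding \<psi>_def by (intro rot_mult test0D f g)
  have int: "integrable lborel (\<lambda>x. f x * rot i j g x / norm x ^ 4)"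
    "integrable lborel (\<lambda>x. rot i j f x * g x / norm x ^ 4)"
    using f g by (auto intro!: integrable_weighted_inner N test0_rot test0D)
  have "(\<lambda>m. \<integral>x. ?w m x * \<psi> x \<partial>lborel) \<longlonglongrightarrow> (\<integral>x. \<psi> x / norm x ^ 4 \<partial>lborel)"
  proof (rule weighted_integral_limit(1))
    show "\<psi> \<in> borel_measurable borel"
      unfolding \<psi>_def by (intro test_functions_measurable test_functions_rot tf)
    show "integrable lborel (\<lambda>x. \<psi> x / norm x ^ 4)"
      unfolding \<psi> add_divide_distrib by (intro Bochner_Integration.integrable_add int)
    show "\<psi> 0 = 0" by (simp add: \<psi>_def rot_def)
  qed (use regularized_weights in \<open>auto simp del: of_nat_Suc\<close>)
  moreover have "(\<integral>x. ?w m x * \<psi> x \<partial>lborel) = 0" for m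
    unfolding \<psi>_def by (rule integral_rot_regularized[OF tf]) simp
  ultimately have "(\<integral>x. \<psi> x / norm x ^ 4 \<partial>lborel) = 0"
    by (simp add: LIMSEQ_const_iff)
  then show ?thesis
    unfolding \<psi> add_divide_distrib weighted_inner_def using int by simp
qed

text \<open>In the constant \<open>N - 4\<close>, N is the divergence of the field \<open>x\<close>
  and -4 the homogeneity of the weight; their regularized versions are \<open>?w\<close> and
  \<open>?v\<close>.\<close>

lemma weighted_inner_euler:
  fixes f g :: "real^'n::finite \<Rightarrow> real"
  assumes N: "CARD('n) \<ge> 3" and f: "f \<in> test0" and g: "g \<in> test0"
  shows "weighted_inner (euler f) g = - weighted_inner f (euler g) - (real CARD('n) - 4) * weighted_inner f g"
proof -
  let ?w = "\<lambda>m (x::real^'n). inverse ((x \<bullet> x + inverse (real (Suc m)))\<^sup>2)"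
  let ?v = "\<lambda>m (x::real^'n). (x \<bullet> x) * inverse ((x \<bullet> x + inverse (real (Suc m))) ^ 3)"
  define \<phi> where "\<phi> = (\<lambda>x. f x * g x)"
  define \<psi> where "\<psi> = (\<lambda>x. euler \<phi> x + real CARD('n) * \<phi> x)"
  have tf: "\<phi> \<in> test_functions"
    unfolding \<phi>_def by (intro test_functions_mult_smooth test0D(2)[OF f] test0D(1)[OF g])
  have \<psi>: "\<psi> x = f x * euler g x + euler f x * g x + real CARD('n) * \<phi> x" for x
    unfolding \<psi>_def \<phi>_def using euler_mult[OF test0D(2)[OF f] test0D(2)[OF g]] by simp
  have int: "integrable lborel (\<lambda>x. f x * euler g x / norm x ^ 4)"
    "integrable lborel (\<lambda>x. euler f x * g x / norm x ^ 4)"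
    "integrable lborel (\<lambda>x. \<phi> x / norm x ^ 4)"
    using f g unfolding \<phi>_def by (auto intro!: integrable_weighted_inner N test0_euler test0D)
  have m: "\<phi> \<in> borel_measurable borel" "\<psi> \<in> borel_measurable borel"
    unfolding \<psi>_def by (intro test_functions_measurable test_functions_euler test_functions_add
      test_functions_mult_smooth smooth_const tf)+
  have int\<psi>: "integrable lborel (\<lambda>x. \<psi> x / norm x ^ 4)"
    unfolding \<psi> add_divide_distrib times_divide_eq_right[of "real CARD('n)", symmetric]
    by (intro Bochner_Integration.integrable_add integrable_mult_right int)
  have 0: "\<phi> 0 = 0" "\<psi> 0 = 0"
    using f by (auto simp: \<psi>_def \<phi>_def test0_def euler_def)
  have mw: "?w m \<in> borel_measurable borel" "?v m \<in> borel_measurable borel" for m :: nat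
    by measurable
  have W: "(\<lambda>m. \<integral>x. ?w m x * \<psi> x \<partial>lborel) \<longlonglongrightarrow> (\<integral>x. \<psi> x / norm x ^ 4 \<partial>lborel)"
    "integrable lborel (\<lambda>x. ?w m x * \<psi> x)" for m
    by (rule weighted_integral_limit[OF m(2) mw(1) int\<psi> 0(2)]; (rule regularized_weights; assumption?))+
  have V: "(\<lambda>m. \<integral>x. ?v m x * \<phi> x \<partial>lborel) \<longlonglongrightarrow> (\<integral>x. \<phi> x / norm x ^ 4 \<partial>lborel)"
    "integrable lborel (\<lambda>x. ?v m x * \<phi> x)" for m
    by (rule weighted_integral_limit[OF m(1) mw(2) int(3) 0(1)]; (rule regularized_weights; assumption?))+
  have "(\<integral>x. ?w m x * \<psi> x - 4 * (?v m x * \<phi> x) \<partial>lborel) = 0" for m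
    using integral_euler_regularized[OF tf, of "inverse (real (Suc m))"]
    by (simp add: \<psi>_def mult.assoc del: of_nat_Suc)
  then have "(\<integral>x. ?w m x * \<psi> x \<partial>lborel) - 4 * (\<integral>x. ?v m x * \<phi> x \<partial>lborel) = 0" for m
    using Bochner_Integration.integral_diff[OF W(2)[of m] integrable_mult_right[OF V(2)[of m], of 4]]
    unfolding integral_mult_right_zero by (simp only:)
  moreover have "(\<lambda>m. (\<integral>x. ?w m x * \<psi> x \<partial>lborel) - 4 * (\<integral>x. ?v m x * \<phi> x \<partial>lborel))
      \<longlonglongrightarrow> (\<integral>x. \<psi> x / norm x ^ 4 \<partial>lborel) - 4 * (\<integral>x. \<phi> x / norm x ^ 4 \<partial>lborel)"
    by (intro tendsto_intros W(1) V(1))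
  ultimately have "(\<integral>x. \<psi> x / norm x ^ 4 \<partial>lborel) - 4 * (\<integral>x. \<phi> x / norm x ^ 4 \<partial>lborel) = 0"
    by (simp add: LIMSEQ_const_iff del: of_nat_Suc)
  moreover have "(\<integral>x. \<psi> x / norm x ^ 4 \<partial>lborel) = weighted_inner f (euler g) + weighted_inner (euler f) g + real CARD('n) * weighted_inner f g"
  proof -
    have "\<psi> x / norm x ^ 4 = (f x * euler g x / norm x ^ 4 + euler f x * g x / norm x ^ 4)
        + real CARD('n) * (\<phi> x / norm x ^ 4)" for x
      by (simp add: \<psi> add_divide_distrib)
    moreover have "weighted_inner f g = (\<integral>x. \<phi> x / norm x ^ 4 \<partial>lborel)"
      by (simp add: weighted_inner_def \<phi>_def)
    ultimately show ?thesis
      by (simp only: weighted_inner_def Bochner_Integration.integral_add Bochner_Integration.integrable_add int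
          integrable_mult_right integral_mult_right_zero)
  qed
  ultimately show ?thesis
    by (simp add: weighted_inner_def \<phi>_def algebra_simps)
qed

subsection \<open>The Hardy--Rellich inequality\<close>

lemma weighted_inner_commute: "weighted_inner f g = weighted_inner g f"
  by (simp add: weighted_inner_def mult.commute)

lemma weighted_inner_self_nonneg: "weighted_inner f f \<ge> 0"
  by (simp add: weighted_inner_def)

context
  assumes N: "CARD('n::finite) \<ge> 3"
begin

lemma weighted_inner_add_left:
  fixes f g h :: "real^'n \<Rightarrow> real"
  assumes "f \<in> test0" "g \<in> test0" "h \<in> test0"
  shows "weighted_inner (\<lambda>x. f x + g x) h = weighted_inner f h + weighted_inner g h"
  using integrable_weighted_inner[OF N assms(1,3)] integrable_weighted_inner[OF N assms(2,3)]
  by (simp add: weighted_inner_def distrib_right add_divide_distrib)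

lemma weighted_inner_cmult_left:
  fixes f h :: "real^'n \<Rightarrow> real"
  shows "weighted_inner (\<lambda>x. c * f x) h = c * weighted_inner f h"
  by (simp add: weighted_inner_def mult.assoc flip: times_divide_eq_right)

lemma weighted_inner_sum_left:
  fixes f :: "'i \<Rightarrow> real^'n \<Rightarrow> real"
  assumes "\<And>i. i \<in> I \<Longrightarrow> f i \<in> test0" "h \<in> test0"
  shows "weighted_inner (\<lambda>x. \<Sum>i\<in>I. f i x) h = (\<Sum>i\<in>I. weighted_inner (f i) h)"
  using integrable_weighted_inner[OF N assms(1) assms(2)]
  by (simp add: weighted_inner_def sum_distrib_right sum_divide_distrib)

lemma weighted_inner_square_add:
  fixes f g :: "real^'n \<Rightarrow> real"
  assumes f: "f \<in> test0" and g: "g \<in> test0"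
  shows "weighted_inner (\<lambda>x. f x + c * g x) (\<lambda>x. f x + c * g x) = weighted_inner f f + 2 * c * weighted_inner f g + c\<^sup>2 * weighted_inner g g"
proof -
  have cg: "(\<lambda>x. c * g x) \<in> test0" by (intro test0_cmult g)
  have fg: "(\<lambda>x. f x + c * g x) \<in> test0" by (intro test0_add f cg)
  have *: "weighted_inner k (\<lambda>x. f x + c * g x) = weighted_inner k f + c * weighted_inner k g" if "k \<in> test0" for k
    using weighted_inner_add_left[OF f cg that] by (simp add: weighted_inner_commute[of k] weighted_inner_cmult_left)
  show ?thesis
    unfolding weighted_inner_add_left[OF f cg fg] weighted_inner_cmult_left *[OF f] *[OF g]
    by (simp add: weighted_inner_commute[of g f] power2_eq_square algebra_simps)
qed

lemma weighted_inner_euler_self: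
  fixes f :: "real^'n \<Rightarrow> real"
  assumes f: "f \<in> test0"
  shows "weighted_inner (euler f) f = - ((real CARD('n) - 4) / 2) * weighted_inner f f"
  using weighted_inner_euler[OF N f f] by (simp add: weighted_inner_commute[of f "euler f"] field_simps)

text \<open>Hardy's inequality for radial derivatives: expand the square of
  \<open>euler f + a * f\<close>, whose mixed term is known from
  \<open>weighted_inner_euler_self\<close>.\<close>

lemma hardy_euler:
  fixes f :: "real^'n \<Rightarrow> real"
  assumes f: "f \<in> test0"
  shows "((real CARD('n) - 4) / 2)\<^sup>2 * weighted_inner f f \<le> weighted_inner (euler f) (euler f)"
proof -
  define a where "a = (real CARD('n) - 4) / 2"
  have "0 \<le> weighted_inner (\<lambda>x. euler f x + a * f x) (\<lambda>x. euler f x + a * f x)"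
    by (rule weighted_inner_self_nonneg)
  also have "\<dots> = weighted_inner (euler f) (euler f) + 2 * a * (- a * weighted_inner f f) + a\<^sup>2 * weighted_inner f f"
    unfolding weighted_inner_square_add[OF test0_euler[OF test0D(1)[OF f]] f] weighted_inner_euler_self[OF f] a_def ..
  finally show ?thesis
    unfolding a_def[symmetric] by (simp add: power2_eq_square)
qed

lemma weighted_inner_casimir:
  fixes f u :: "real^'n \<Rightarrow> real"
  assumes f: "f \<in> test0" and u: "u \<in> test_functions"
  shows "weighted_inner (casimir u) f = - (1/2) * (\<Sum>i\<in>UNIV. \<Sum>j\<in>UNIV. weighted_inner (rot i j u) (rot i j f))"
proof -
  have t: "rot i j (rot i j u) \<in> test0" "rot i j u \<in> test0" for i j
    using u by (auto intro: test0_rot test_functions_rot)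
  have "weighted_inner (casimir u) f = (1/2) * (\<Sum>i\<in>UNIV. \<Sum>j\<in>UNIV. weighted_inner (rot i j (rot i j u)) f)"
    unfolding casimir_def weighted_inner_cmult_left using t f by (simp add: weighted_inner_sum_left test0_sum)
  then show ?thesis
    using weighted_inner_rot[OF N t(2) f] by (simp add: sum_negf)
qed

end

text \<open>Lichnerowicz's argument; \<open>N - 1\<close> is the first nonzero eigenvalue of the
  unit sphere. Moving rotations across twice turns the norm of \<open>casimir u\<close> into the sum
  of all squared second rotations, to which the integrated Bochner inequality applies.\<close>

lemma casimir_spectral_gap:
  fixes u :: "real^'n::finite \<Rightarrow> real"
  assumes N: "CARD('n) \<ge> 3" and u: "u \<in> test_functions"
  shows "(real CARD('n) - 1) * ((1/2) * (\<Sum>i\<in>UNIV. \<Sum>j\<in>UNIV. weighted_inner (rot i j u) (rot i j u)))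
    \<le> weighted_inner (casimir u) (casimir u)"
proof -
  define n where "n = real CARD('n)"
  have n: "n \<ge> 3" using N by (simp add: n_def)
  define B where "B = (1/2) * (\<Sum>i\<in>UNIV. \<Sum>j\<in>UNIV. weighted_inner (rot i j u) (rot i j u))"
  have su: "smooth u" using u by (rule test_functions_smooth)
  have v: "rot k l u \<in> test0" "rot k l u \<in> test_functions" for k l
    using u by (auto intro: test0_rot test_functions_rot)
  have w: "rot i j (rot k l u) \<in> test0" for i j k l
    using v by (auto intro: test0_rot)
  have c: "casimir u \<in> test0" using u by (rule test0_casimir)
  have "weighted_inner (casimir u) (casimir u) =
      - (1/2) * (\<Sum>k\<in>UNIV. \<Sum>l\<in>UNIV. weighted_inner (rot k l u) (casimir (rot k l u)))"
    unfolding weighted_inner_casimir[OF N c u] rot_casimir[OF su] ..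
  also have "\<dots> = - (1/2) * (\<Sum>k\<in>UNIV. \<Sum>l\<in>UNIV. - (1/2) *
      (\<Sum>i\<in>UNIV. \<Sum>j\<in>UNIV. weighted_inner (rot i j (rot k l u)) (rot i j (rot k l u))))"
    unfolding weighted_inner_commute[of "rot _ _ u" "casimir _"] weighted_inner_casimir[OF N v] ..
  also have "\<dots> = (1/4) * (\<Sum>k\<in>UNIV. \<Sum>l\<in>UNIV.
      \<Sum>i\<in>UNIV. \<Sum>j\<in>UNIV. weighted_inner (rot i j (rot k l u)) (rot i j (rot k l u)))"
    by (simp only: sum_distrib_left[symmetric])
  also have "\<dots> = (\<integral>x. (1/4) * (\<Sum>k\<in>UNIV. \<Sum>l\<in>UNIV. \<Sum>i\<in>UNIV. \<Sum>j\<in>UNIV.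
      rot i j (rot k l u) x * rot i j (rot k l u) x / norm x ^ 4) \<partial>lborel)"
    by (simp only: weighted_inner_def Bochner_Integration.integral_sum Bochner_Integration.integrable_sum
        integrable_weighted_inner[OF N w w] integral_mult_right_zero)
  also have "\<dots> \<ge> (\<integral>x. (1 / (n - 1)) * (casimir u x * casimir u x / norm x ^ 4)
      + (n - 2) * ((1/2) * (\<Sum>i\<in>UNIV. \<Sum>j\<in>UNIV. rot i j u x * rot i j u x / norm x ^ 4)) \<partial>lborel)"
  proof (rule integral_mono)
    fix x :: "real^'n"
    have "(1 / (n - 1)) * (casimir u x * casimir u x / norm x ^ 4)
        + (n - 2) * ((1/2) * (\<Sum>i\<in>UNIV. \<Sum>j\<in>UNIV. rot i j u x * rot i j u x / norm x ^ 4)) =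
      ((casimir u x)\<^sup>2 / (n - 1) + (n - 2) * ((1/2) * (\<Sum>i\<in>UNIV. \<Sum>j\<in>UNIV. (rot i j u x)\<^sup>2))) / norm x ^ 4"
      by (simp add: power2_eq_square add_divide_distrib sum_divide_distrib[symmetric])
    also have "\<dots> \<le> ((1/4) * (\<Sum>k\<in>UNIV. \<Sum>l\<in>UNIV. \<Sum>i\<in>UNIV. \<Sum>j\<in>UNIV. (rot i j (rot k l u) x)\<^sup>2)) / norm x ^ 4"
      using bochner_pointwise[OF su, of x] N unfolding n_def by (intro divide_right_mono) auto
    also have "\<dots> = (1/4) * (\<Sum>k\<in>UNIV. \<Sum>l\<in>UNIV. \<Sum>i\<in>UNIV. \<Sum>j\<in>UNIV.
      rot i j (rot k l u) x * rot i j (rot k l u) x / norm x ^ 4)"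
      by (simp add: power2_eq_square sum_divide_distrib[symmetric])
    finally show "(1 / (n - 1)) * (casimir u x * casimir u x / norm x ^ 4)
        + (n - 2) * ((1/2) * (\<Sum>i\<in>UNIV. \<Sum>j\<in>UNIV. rot i j u x * rot i j u x / norm x ^ 4)) \<le>
      (1/4) * (\<Sum>k\<in>UNIV. \<Sum>l\<in>UNIV. \<Sum>i\<in>UNIV. \<Sum>j\<in>UNIV.
      rot i j (rot k l u) x * rot i j (rot k l u) x / norm x ^ 4)" .
  qed (intro Bochner_Integration.integrable_add Bochner_Integration.integrable_sum integrable_mult_right
      integrable_weighted_inner N c v w)+
  also have "(\<integral>x. (1 / (n - 1)) * (casimir u x * casimir u x / norm x ^ 4)
      + (n - 2) * ((1/2) * (\<Sum>i\<in>UNIV. \<Sum>j\<in>UNIV. rot i j u x * rot i j u x / norm x ^ 4)) \<partial>lborel)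
      = 1 / (n - 1) * weighted_inner (casimir u) (casimir u) + (n - 2) * B"
    unfolding B_def
    by (simp only: weighted_inner_def Bochner_Integration.integral_add Bochner_Integration.integrable_add
        Bochner_Integration.integral_sum Bochner_Integration.integrable_sum
        integrable_weighted_inner[OF N v(1) v(1)] integrable_weighted_inner[OF N c c] integrable_mult_right integral_mult_right_zero)
  finally have "(n - 2) * B \<le> (1 - 1 / (n - 1)) * weighted_inner (casimir u) (casimir u)"
    by (simp add: algebra_simps)
  \<comment> \<open>The norm of \<open>casimir u\<close> occurs on both sides of the Bochner
    inequality; after collecting it, the common factor \<open>n - 2\<close> is positive and
    cancels.\<close>
  also have "1 - 1 / (n - 1) = (n - 2) / (n - 1)"
    using n by (simp add: field_simps)
  finally have "(n - 2) * ((n - 1) * B) \<le> (n - 2) * weighted_inner (casimir u) (casimir u)"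
    using n by (simp add: field_simps)
  then have "(n - 1) * B \<le> weighted_inner (casimir u) (casimir u)"
    using n by (subst (asm) mult_le_cancel_left_pos) auto
  then show ?thesis unfolding n_def B_def .
qed

text \<open>\<open>T\<close> is the radial part \<open>K\<close> plus \<open>casimir u\<close>. The
  square of \<open>K\<close> yields the first term and twice the mixed product at least the second,
  while the square of \<open>casimir u\<close> is kept. The last claim is a separate input for
  dimension 3.\<close>

lemma laplacian_lower_bound:
  fixes u :: "real^'n::finite \<Rightarrow> real"
  assumes N: "CARD('n) \<ge> 3" and u: "u \<in> test_functions"
  defines "n \<equiv> real CARD('n)"
    and "B \<equiv> (1/2) * (\<Sum>i\<in>UNIV. \<Sum>j\<in>UNIV. weighted_inner (rot i j u) (rot i j u))"
    and "T \<equiv> \<lambda>x. (x \<bullet> x) * laplacian u x"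
  shows "T \<in> test0"
    and "n\<^sup>2 / 4 * weighted_inner (euler u) (euler u) + n * (n - 4) / 2 * B + weighted_inner (casimir u) (casimir u) \<le> weighted_inner T T"
    and "weighted_inner (casimir u) (euler u) = (n - 4) / 2 * B"
proof -
  define a where "a = (n - 4) / 2"
  have n: "n \<ge> 3" using N by (simp add: n_def)
  have su: "smooth u" using u by (rule test_functions_smooth)
  define h where "h = euler u"
  define D where "D = euler h"
  define \<Lambda> where "\<Lambda> = casimir u"
  have h: "h \<in> test0" "h \<in> test_functions"
    unfolding h_def using u by (auto intro: test0_euler test_functions_euler)
  have D: "D \<in> test0" unfolding D_def using h by (auto intro: test0_euler)
  have L: "\<Lambda> \<in> test0" unfolding \<Lambda>_def using u by (rule test0_casimir)
  have v: "rot i j u \<in> test0" "euler (rot i j u) \<in> test0" for i j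
    using u by (auto intro!: test0_rot test0_euler test_functions_rot)
  define K where "K = (\<lambda>x. D x + (n - 2) * h x)"
  have K: "K \<in> test0" unfolding K_def by (intro test0_add test0_cmult D h)
  have T: "T = (\<lambda>x. K x + 1 * \<Lambda> x)"
    unfolding T_def K_def D_def h_def \<Lambda>_def n_def casimir_eq[OF su] by (simp add: algebra_simps)
  show "T \<in> test0" unfolding T by (intro test0_add test0_cmult K L)
  have Dh: "weighted_inner D h = - a * weighted_inner h h"
    unfolding D_def a_def n_def by (rule weighted_inner_euler_self[OF N h(1)])
  have "weighted_inner K K = weighted_inner D D + 2 * (n - 2) * weighted_inner D h + (n - 2)\<^sup>2 * weighted_inner h h"
    unfolding K_def by (rule weighted_inner_square_add[OF N D h(1)])
  moreover have "a\<^sup>2 * weighted_inner h h \<le> weighted_inner D D"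
    unfolding D_def a_def n_def by (rule hardy_euler[OF N h(1)])
  \<comment> \<open>This is the square of \<open>n - 2 - a\<close>, which equals
    \<open>n / 2\<close>.\<close>
  moreover have "a\<^sup>2 + 2 * (n - 2) * (- a) + (n - 2)\<^sup>2 = n\<^sup>2 / 4"
    by (simp add: a_def power2_eq_square field_simps)
  then have "a\<^sup>2 * weighted_inner h h + 2 * (n - 2) * (- a * weighted_inner h h) + (n - 2)\<^sup>2 * weighted_inner h h = n\<^sup>2 / 4 * weighted_inner h h"
    by (metis (no_types, opaque_lifting) distrib_right mult.assoc)
  ultimately have KK: "n\<^sup>2 / 4 * weighted_inner h h \<le> weighted_inner K K" unfolding Dh by linarith
  have Lh: "weighted_inner \<Lambda> h = a * B"
  proof -
    have "weighted_inner \<Lambda> h = - (1/2) * (\<Sum>i\<in>UNIV. \<Sum>j\<in>UNIV. weighted_inner (rot i j u) (euler (rot i j u)))"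
      unfolding \<Lambda>_def weighted_inner_casimir[OF N h(1) u] unfolding h_def rot_euler[OF su] ..
    also have "\<dots> = - (1/2) * (\<Sum>i\<in>UNIV. \<Sum>j\<in>UNIV. - a * weighted_inner (rot i j u) (rot i j u))"
      unfolding a_def n_def weighted_inner_commute[of "rot _ _ u" "euler _"] weighted_inner_euler_self[OF N v(1)] ..
    finally show ?thesis by (simp only: sum_distrib_left[symmetric] B_def)
  qed
  then show "weighted_inner (casimir u) (euler u) = (n - 4) / 2 * B"
    by (simp add: \<Lambda>_def h_def a_def)
  \<comment> \<open>Moving rotations across and commuting them with dilations leaves products of
    \<open>?v\<close> with \<open>euler (euler ?v)\<close>. Integrating by parts and using
    \<open>hardy_euler\<close> bounds each by \<open>a\<^sup>2\<close> times the square norm of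
    \<open>?v\<close>.\<close>
  have LD: "- (a\<^sup>2 * B) \<le> weighted_inner \<Lambda> D"
  proof -
    have "weighted_inner \<Lambda> D = - (1/2) * (\<Sum>i\<in>UNIV. \<Sum>j\<in>UNIV. weighted_inner (rot i j u) (euler (euler (rot i j u))))"
      unfolding \<Lambda>_def weighted_inner_casimir[OF N D u]
      unfolding D_def h_def rot_euler[OF smooth_euler[OF su]] rot_euler[OF su] ..
    also have "\<dots> \<ge> - (1/2) * (\<Sum>i\<in>UNIV. \<Sum>j\<in>UNIV. a\<^sup>2 * weighted_inner (rot i j u) (rot i j u))"
    proof (intro mult_left_mono_neg sum_mono)
      fix i j
      let ?v = "rot i j u"
      have "weighted_inner ?v (euler (euler ?v)) = - weighted_inner (euler ?v) (euler ?v) - (n - 4) * weighted_inner (euler ?v) ?v"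
        using weighted_inner_euler[OF N v(2) v(1)] weighted_inner_commute[of ?v] by (simp add: n_def)
      also have "\<dots> = - weighted_inner (euler ?v) (euler ?v) + 2 * (a\<^sup>2 * weighted_inner ?v ?v)"
        unfolding weighted_inner_euler_self[OF N v(1)] n_def[symmetric] a_def by (simp add: power2_eq_square)
      finally show "weighted_inner ?v (euler (euler ?v)) \<le> a\<^sup>2 * weighted_inner ?v ?v"
        using hardy_euler[OF N v(1)[of i j]] unfolding n_def[symmetric] a_def[symmetric] by linarith
    qed simp
    finally show ?thesis by (simp only: sum_distrib_left[symmetric] B_def)
  qed
  have "weighted_inner K \<Lambda> = weighted_inner D \<Lambda> + (n - 2) * weighted_inner h \<Lambda>"
    unfolding K_def using weighted_inner_add_left[OF N D test0_cmult[OF h(1)] L] weighted_inner_cmult_left[OF N] by simp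
  then have KL: "weighted_inner K \<Lambda> \<ge> - (a\<^sup>2 * B) + (n - 2) * (a * B)"
    using LD Lh by (simp add: weighted_inner_commute[of D] weighted_inner_commute[of h])
  \<comment> \<open>Both sides are \<open>a * n * B\<close>, again because
    \<open>n - 2 - a = n / 2\<close>.\<close>
  have "2 * (- (a\<^sup>2 * B) + (n - 2) * (a * B)) = n * (n - 4) / 2 * B"
    by (simp add: a_def power2_eq_square field_simps)
  moreover have "weighted_inner T T = weighted_inner K K + 2 * 1 * weighted_inner K \<Lambda> + 1\<^sup>2 * weighted_inner \<Lambda> \<Lambda>"
    unfolding T by (rule weighted_inner_square_add[OF N K L])
  ultimately have "n\<^sup>2 / 4 * weighted_inner h h + n * (n - 4) / 2 * B + weighted_inner \<Lambda> \<Lambda> \<le> weighted_inner T T"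
    using KK KL by simp
  then show "n\<^sup>2 / 4 * weighted_inner (euler u) (euler u) + n * (n - 4) / 2 * B + weighted_inner (casimir u) (casimir u) \<le> weighted_inner T T"
    unfolding h_def \<Lambda>_def .
qed

lemma hardy_rellich_weighted_inner:
  fixes u :: "real^'n::finite \<Rightarrow> real"
  assumes N: "CARD('n) \<ge> 3" and u: "u \<in> test_functions"
  defines "T \<equiv> \<lambda>x. (x \<bullet> x) * laplacian u x"
  shows "hardy_rellich_const CARD('n) * (weighted_inner (euler u) (euler u)
    + (1/2) * (\<Sum>i\<in>UNIV. \<Sum>j\<in>UNIV. weighted_inner (rot i j u) (rot i j u))) \<le> weighted_inner T T"
proof -
  define n where "n = real CARD('n)"
  define B where "B = (1/2) * (\<Sum>i\<in>UNIV. \<Sum>j\<in>UNIV. weighted_inner (rot i j u) (rot i j u))"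
  define H where "H = weighted_inner (euler u) (euler u)"
  define L where "L = weighted_inner (casimir u) (casimir u)"
  have B: "B \<ge> 0" unfolding B_def by (intro mult_nonneg_nonneg sum_nonneg weighted_inner_self_nonneg) simp
  have H: "H \<ge> 0" unfolding H_def by (rule weighted_inner_self_nonneg)
  have T: "n\<^sup>2 / 4 * H + n * (n - 4) / 2 * B + L \<le> weighted_inner T T"
    using laplacian_lower_bound(2)[OF N u] unfolding n_def B_def H_def L_def T_def .
  have gap: "(n - 1) * B \<le> L"
    using casimir_spectral_gap[OF N u] unfolding n_def B_def L_def .
  consider "CARD('n) = 3" | "CARD('n) = 4" | "CARD('n) \<ge> 5" using N by linarith
  then have "hardy_rellich_const CARD('n) * (H + B) \<le> n\<^sup>2 / 4 * H + n * (n - 4) / 2 * B + L"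
  proof cases
    case 1
    have cu: "casimir u \<in> test0" "euler u \<in> test0"
      using u by (auto intro: test0_casimir test0_euler)
    \<comment> \<open>The spectral gap alone is too weak in dimension 3; the remainder is
      \<open>65/72\<close> times the gap plus \<open>7/72\<close> times the square below.\<close>
    have "0 \<le> L + 2 * 4 * weighted_inner (casimir u) (euler u) + 4\<^sup>2 * H"
      using weighted_inner_self_nonneg[of "\<lambda>x. casimir u x + 4 * euler u x"]
      unfolding weighted_inner_square_add[OF N cu] L_def H_def .
    \<comment> \<open>In dimension 3 the mixed product is \<open>- B / 2\<close>, which enters with
      factor 8.\<close>
    then have "0 \<le> L - 4 * B + 16 * H"
      unfolding laplacian_lower_bound(3)[OF N u] B_def[symmetric] using 1 by simp
    then show ?thesis
      using gap 1 by (simp add: n_def hardy_rellich_const_def power2_eq_square)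
  next
    \<comment> \<open>Here \<open>n * (n - 4)\<close> vanishes, so the constant 3 for
      \<open>B\<close> is the spectral gap \<open>n - 1\<close>; the coefficient 4 of
      \<open>H\<close> leaves slack.\<close>
    case 2
    then show ?thesis
      using gap H by (simp add: n_def hardy_rellich_const_def)
  next
    case 3
    then have n: "n \<ge> 5" by (simp add: n_def)
    \<comment> \<open>What remains as coefficient of \<open>B\<close> once
      \<open>n\<^sup>2 / 4\<close> is taken off. It is negative at \<open>n = 4\<close>, which is
      why the case \<open>n \<ge> 5\<close> starts where it does.\<close>
    have "0 \<le> n * (n - 4) / 4 - 1"
      using mult_mono[of 5 n 1 "n - 4"] n by simp
    then have "0 \<le> (n * (n - 4) / 2 + (n - 1) - n\<^sup>2 / 4) * B"
      using B by (intro mult_nonneg_nonneg) (simp_all add: power2_eq_square field_simps)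
    then show ?thesis
      using gap 3 by (simp add: n_def[symmetric] hardy_rellich_const_def power2_eq_square field_simps)
  qed
  with T show ?thesis unfolding H_def B_def by linarith
qed

theorem theorem1:
  fixes u :: "real^'n::finite \<Rightarrow> real"
  assumes "CARD('n) \<ge> 3"
    and "u \<in> test_functions"
  shows "(\<integral>\<^sup>+x. ennreal (\<bar>laplacian u x\<bar>\<^sup>2) \<partial>lborel) \<ge>
    ennreal (hardy_rellich_const CARD('n)) *
      (\<integral>\<^sup>+x. ennreal ((norm (gradient u x))\<^sup>2 / (norm x)\<^sup>2) \<partial>lborel)"
proof -
  note N = assms(1) and u = assms(2)
  define T where "T = (\<lambda>x. (x \<bullet> x) * laplacian u x)"
  have T: "T \<in> test0" unfolding T_def by (rule laplacian_lower_bound(1)[OF N u])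
  have v: "rot i j u \<in> test0" "euler u \<in> test0" for i j
    using u by (auto intro: test0_rot test0_euler)
  \<comment> \<open>At the origin the right-hand integrand is 0 by division by zero whatever the
    Laplacian is there, so the two integrands agree only almost everywhere.\<close>
  have "AE x in lborel. x \<noteq> (0::real^'n)" by (rule AE_lborel_singleton)
  then have "AE x in lborel. ennreal (\<bar>laplacian u x\<bar>\<^sup>2) = ennreal (T x * T x / norm x ^ 4)"
  proof eventually_elim
    case (elim x)
    then have "T x * T x / norm x ^ 4 = (laplacian u x)\<^sup>2"
      by (simp add: T_def dot_square_norm power2_eq_square power4_eq_xxxx)
    then show ?case by simp
  qed
  then have "(\<integral>\<^sup>+x. ennreal (\<bar>laplacian u x\<bar>\<^sup>2) \<partial>lborel) = (\<integral>\<^sup>+x. ennreal (T x * T x / norm x ^ 4) \<partial>lborel)"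
    by (rule nn_integral_cong_AE)
  also have "\<dots> = ennreal (weighted_inner T T)"
    unfolding weighted_inner_def by (intro nn_integral_eq_integral integrable_weighted_inner N T) auto
  finally have lap: "(\<integral>\<^sup>+x. ennreal (\<bar>laplacian u x\<bar>\<^sup>2) \<partial>lborel) = ennreal (weighted_inner T T)" .
  let ?q = "\<lambda>x. euler u x * euler u x / norm x ^ 4
    + (1/2) * (\<Sum>i\<in>UNIV. \<Sum>j\<in>UNIV. rot i j u x * rot i j u x / norm x ^ 4)"
  \<comment> \<open>True also at the origin, where both sides are 0 by division by zero. Elsewhere
    it is the splitting of the gradient in \<open>sum_rot_squared\<close>.\<close>
  have q: "(norm (gradient u x))\<^sup>2 / (norm x)\<^sup>2 = ?q x" for x
  proof -
    have "?q x = ((euler u x)\<^sup>2 + (1/2) * (\<Sum>i\<in>UNIV. \<Sum>j\<in>UNIV. (rot i j u x)\<^sup>2)) / norm x ^ 4"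
      by (simp add: power2_eq_square add_divide_distrib sum_divide_distrib[symmetric])
    also have "\<dots> = (norm x)\<^sup>2 * (norm (gradient u x))\<^sup>2 / norm x ^ 4"
      unfolding sum_rot_squared by (simp add: dot_square_norm field_simps)
    also have "\<dots> = (norm (gradient u x))\<^sup>2 / (norm x)\<^sup>2"
      by (simp add: power2_eq_square power4_eq_xxxx)
    finally show ?thesis ..
  qed
  have "(\<integral>\<^sup>+x. ennreal (?q x) \<partial>lborel) = ennreal (\<integral>x. ?q x \<partial>lborel)"
  proof (rule nn_integral_eq_integral)
    show "integrable lborel ?q"
      by (intro Bochner_Integration.integrable_add Bochner_Integration.integrable_sum integrable_mult_right
          integrable_weighted_inner N v)
    show "AE x in lborel. 0 \<le> ?q x"
      by (intro AE_I2 add_nonneg_nonneg mult_nonneg_nonneg[of "1/2"] sum_nonneg divide_nonneg_nonneg) auto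
  qed
  also have "(\<integral>x. ?q x \<partial>lborel) = weighted_inner (euler u) (euler u)
      + (1/2) * (\<Sum>i\<in>UNIV. \<Sum>j\<in>UNIV. weighted_inner (rot i j u) (rot i j u))"
    by (simp only: weighted_inner_def Bochner_Integration.integral_add Bochner_Integration.integrable_add
        Bochner_Integration.integral_sum Bochner_Integration.integrable_sum
        integrable_weighted_inner[OF N v(1) v(1)] integrable_weighted_inner[OF N v(2) v(2)] integrable_mult_right integral_mult_right_zero)
  finally have "(\<integral>\<^sup>+x. ennreal ((norm (gradient u x))\<^sup>2 / (norm x)\<^sup>2) \<partial>lborel) =
      ennreal (weighted_inner (euler u) (euler u) + (1/2) * (\<Sum>i\<in>UNIV. \<Sum>j\<in>UNIV. weighted_inner (rot i j u) (rot i j u)))"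
    unfolding q .
  then show ?thesis
    unfolding lap using hardy_rellich_weighted_inner[OF N u]
    by (simp add: T_def hardy_rellich_const_def ennreal_mult'[symmetric] ennreal_leI)
qed

end
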